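(* Let $(\Omega,g)$ be an $n$-dimensional Riemannian manifold, let $\mathfrak{X}$ be the space of vector fields on $\Omega$, let $\boldsymbol{V}\in\mathfrak{X}$, and let $K:\mathfrak{X}\to\mathbb{R}$ be a functional with variational derivative $\frac{\delta K}{\delta\boldsymbol{V}}\in\mathfrak{X}$ defined by $$DK[\boldsymbol{V}]\,\delta\boldsymbol{V}=\int_\Omega\Big(\frac{\delta K}{\delta\boldsymbol{V}}\cdot\delta\boldsymbol{V}\Big)\,\mathrm{vol}^n\quad\text{for all }\delta\boldsymbol{V}\in\mathfrak{X}.$$ Let $v^1=\boldsymbol{V}^\flat\in\Lambda^1$ and $\tilde v^{n-1}=\mathbf{i}_{\boldsymbol{V}}\mathrm{vol}^n\in\tilde\Lambda^{n-1}$, and define functionals $\hat K_1:\Lambda^1\to\mathbb{R}$ and $\hat K_2:\tilde\Lambda^{n-1}\to\mathbb{R}$ by $\hat K_1[v^1]=\hat K_2[\tilde v^{n-1}]=K[\boldsymbol{V}]$. Then the twisted functional derivatives are $$\frac{\tilde\delta\hat K_1}{\delta v^1}=\mathbf{i}_{\delta K/\delta\boldsymbol{V}}\,\mathrm{vol}^n\qquad\text{and}\qquad\frac{\tilde\delta\hat K_2}{\delta\tilde v^{n-1}}=\Big(\frac{\delta K}{\delta\boldsymbol{V}}\Big)^\flat .$$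
   Context: $\Lambda^k$ denotes (straight) differential $k$-forms on $\Omega$ and $\tilde\Lambda^k$ twisted $k$-forms (forms that additionally change sign under orientation-reversing changes of coordinates). The volume form $\mathrm{vol}^n$ is a twisted $n$-form; integrals of twisted $n$-forms are orientation independent. $V^\flat=g(\cdot,V)$, $W\cdot V=g(W,V)$, and $\mathbf{i}_V$ is the interior product. The map $V\mapsto\mathbf{i}_V\mathrm{vol}^n$ is an isomorphism $\mathfrak{X}\to\tilde\Lambda^{n-1}$. Poincaré duality pairing (straight form first): $\langle\omega^k,\tilde\eta^{n-k}\rangle=\int_\Omega\omega^k\wedge\tilde\eta^{n-k}$ for $\omega^k\in\Lambda^k$, $\tilde\eta^{n-k}\in\tilde\Lambda^{n-k}$. Twisted functional derivatives: for a functional $F:\Lambda^k\to\mathbb{R}$ with Fréchet derivative $DF[\omega]$, the form $\frac{\tilde\delta F}{\delta\omega}\in\tilde\Lambda^{n-k}$ is defined by $DF[\omega]\eta=\langle\eta,\frac{\tilde\delta F}{\delta\omega}\rangle$ for all $\eta\in\Lambda^k$. For $F:\tilde\Lambda^k\to\mathbb{R}$, the form $\frac{\tilde\delta F}{\delta\tilde\omega}\in\Lambda^{n-k}$ is defined by $DF[\tilde\omega]\tilde\eta=\langle\frac{\tilde\delta F}{\delta\tilde\omega},\tilde\eta\rangle$ for all $\tilde\eta\in\tilde\Lambda^k$. Functionals are assumed differentiable with functional derivatives represented by (sufficiently regular) fields; all integrals are assumed to converge. *)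

theory Defs
  imports "HOL-Analysis.Analysis" "HOL-Library.Function_Algebras"
begin

section \<open>Spaces of fields as real vector spaces\<close>

instantiation "fun" :: (type, scaleR) scaleR
begin

definition scaleR_fun_def: "r *\<^sub>R f = (\<lambda>x. r *\<^sub>R f x)"

instance ..

end

instance "fun" :: (type, real_vector) real_vector
  by standard
    (simp_all add: scaleR_fun_def fun_eq_iff scaleR_add_right scaleR_add_left)

definition normed_subspace :: "'v::real_vector set \<Rightarrow> ('v \<Rightarrow> real) \<Rightarrow> bool" where
  "normed_subspace S N \<longleftrightarrow>
     subspace S \<and>
     (\<forall>u\<in>S. 0 \<le> N u \<and> (N u = 0 \<longleftrightarrow> u = 0)) \<and>
     (\<forall>u\<in>S. \<forall>r. N (r *\<^sub>R u) = \<bar>r\<bar> * N u) \<and>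
     (\<forall>u\<in>S. \<forall>v\<in>S. N (u + v) \<le> N u + N v)"

definition bicontinuous_on ::
  "'v set \<Rightarrow> ('v \<Rightarrow> real) \<Rightarrow> ('w \<Rightarrow> real) \<Rightarrow> ('v \<Rightarrow> 'w) \<Rightarrow> bool" where
  "bicontinuous_on S N N' T \<longleftrightarrow> (\<exists>C. \<forall>u\<in>S. N' (T u) \<le> C * N u \<and> N u \<le> C * N' (T u))"

definition frechet_on ::
  "'v::real_vector set \<Rightarrow> ('v \<Rightarrow> real) \<Rightarrow> ('v \<Rightarrow> real) \<Rightarrow> 'v \<Rightarrow> ('v \<Rightarrow> real) \<Rightarrow> bool" where
  "frechet_on S N F x D \<longleftrightarrow>
     x \<in> S \<and>
     (\<forall>u\<in>S. \<forall>v\<in>S. D (u + v) = D u + D v) \<and>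
     (\<forall>u\<in>S. \<forall>r. D (r *\<^sub>R u) = r * D u) \<and>
     (\<exists>C. \<forall>u\<in>S. \<bar>D u\<bar> \<le> C * N u) \<and>
     (\<forall>\<epsilon>>0. \<exists>\<delta>>0. \<forall>h\<in>S. N h < \<delta> \<longrightarrow> \<bar>F (x + h) - F x - D h\<bar> \<le> \<epsilon> * N h)"


section \<open>Smooth manifolds\<close>

primrec Ck_on ::
  "nat \<Rightarrow> ('a::real_normed_vector \<Rightarrow> 'b::real_normed_vector) \<Rightarrow> 'a set \<Rightarrow> bool" where
  "Ck_on 0 f S \<longleftrightarrow> continuous_on S f"
| "Ck_on (Suc k) f S \<longleftrightarrow>
     (\<exists>f'. (\<forall>x\<in>S. (f has_derivative f' x) (at x)) \<and> (\<forall>v. Ck_on k (\<lambda>x. f' x v) S))"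

definition smooth_on ::
  "('a::real_normed_vector \<Rightarrow> 'b::real_normed_vector) \<Rightarrow> 'a set \<Rightarrow> bool" where
  "smooth_on f S \<longleftrightarrow> (\<forall>k. Ck_on k f S)"

text \<open>A chart is a coordinate domain together with its coordinate map.\<close>

type_synonym ('a, 'n) chart = "'a set \<times> ('a \<Rightarrow> real ^ 'n)"

definition chart_inv :: "('a, 'n) chart \<Rightarrow> real ^ 'n \<Rightarrow> 'a" where
  "chart_inv c = inv_into (fst c) (snd c)"

definition transition :: "('a, 'n) chart \<Rightarrow> ('a, 'n) chart \<Rightarrow> real ^ 'n \<Rightarrow> real ^ 'n" where
  "transition c c' = snd c' \<circ> chart_inv c"

definition transition_jacobian ::
  "('a, 'n::finite) chart \<Rightarrow> ('a, 'n) chart \<Rightarrow> 'a \<Rightarrow> real ^ 'n ^ 'n" where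
  "transition_jacobian c c' p = jacobian (transition c c') (at (snd c p))"

definition smooth_manifold :: "'a topology \<Rightarrow> ('a, 'n::finite) chart set \<Rightarrow> bool" where
  "smooth_manifold M A \<longleftrightarrow>
     Hausdorff_space M \<and> second_countable M \<and>
     (\<Union>c\<in>A. fst c) = topspace M \<and>
     (\<forall>c\<in>A. openin M (fst c) \<and> open (snd c ` fst c) \<and>
        homeomorphic_map (subtopology M (fst c)) (top_of_set (snd c ` fst c)) (snd c)) \<and>
     (\<forall>c\<in>A. \<forall>c'\<in>A. smooth_on (transition c c') (snd c ` (fst c \<inter> fst c')))"


section \<open>Tensor fields\<close>

text \<open>
  A tensor field is a family of component functions, one for each chart of the atlas, related by
  the transformation law of the tensor type.  The value \<open>X c p\<close> is the component array at the
  point \<open>p\<close> in the chart \<open>c\<close>.  Outside the domain of \<open>c\<close>, and for charts not in the atlas,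
  components are zero, so that equality of fields is equality of functions.
\<close>

type_synonym ('a, 'n) vfield = "('a, 'n) chart \<Rightarrow> 'a \<Rightarrow> real ^ 'n"
type_synonym ('a, 'n) mfield = "('a, 'n) chart \<Rightarrow> 'a \<Rightarrow> real ^ 'n ^ 'n"

text \<open>The argument \<open>v\<close> of a \<open>k\<close>-form is a sequence of vectors of which only the
  entries \<open>v 0, ..., v (k - 1)\<close> matter.\<close>

type_synonym 'n form = "(nat \<Rightarrow> real ^ 'n) \<Rightarrow> real"
type_synonym ('a, 'n) fform = "('a, 'n) chart \<Rightarrow> 'a \<Rightarrow> 'n form"

definition vector_fields :: "('a, 'n::finite) chart set \<Rightarrow> ('a, 'n) vfield set" where
  "vector_fields A = {V.
     (\<forall>c p. \<not> (c \<in> A \<and> p \<in> fst c) \<longrightarrow> V c p = 0) \<and>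
     (\<forall>c\<in>A. smooth_on (\<lambda>x. V c (chart_inv c x)) (snd c ` fst c)) \<and>
     (\<forall>c\<in>A. \<forall>c'\<in>A. \<forall>p \<in> fst c \<inter> fst c'. V c' p = transition_jacobian c c' p *v V c p)}"

definition riemannian_metric ::
  "('a, 'n::finite) chart set \<Rightarrow> ('a, 'n) mfield \<Rightarrow> bool" where
  "riemannian_metric A g \<longleftrightarrow>
     (\<forall>c p. \<not> (c \<in> A \<and> p \<in> fst c) \<longrightarrow> g c p = 0) \<and>
     (\<forall>c\<in>A. smooth_on (\<lambda>x. g c (chart_inv c x)) (snd c ` fst c)) \<and>
     (\<forall>c\<in>A. \<forall>p\<in>fst c. transpose (g c p) = g c p \<and> (\<forall>v. v \<noteq> 0 \<longrightarrow> 0 < v \<bullet> (g c p *v v))) \<and>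
     (\<forall>c\<in>A. \<forall>c'\<in>A. \<forall>p \<in> fst c \<inter> fst c'.
        g c p = transpose (transition_jacobian c c' p) ** g c' p ** transition_jacobian c c' p)"

definition riemannian_manifold ::
  "'a topology \<Rightarrow> ('a, 'n::finite) chart set \<Rightarrow> ('a, 'n) mfield \<Rightarrow> bool" where
  "riemannian_manifold M A g \<longleftrightarrow> smooth_manifold M A \<and> riemannian_metric A g"

definition alternating_form :: "nat \<Rightarrow> 'n::finite form \<Rightarrow> bool" where
  "alternating_form k \<alpha> \<longleftrightarrow>
     (\<forall>v w. (\<forall>i<k. v i = w i) \<longrightarrow> \<alpha> v = \<alpha> w) \<and>
     (\<forall>v. \<forall>i<k. linear (\<lambda>x. \<alpha> (v(i := x)))) \<and>
     (\<forall>v. \<forall>i<k. \<forall>j<k. i \<noteq> j \<and> v i = v j \<longrightarrow> \<alpha> v = 0)"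

definition smooth_form_components ::
  "('a, 'n::finite) chart set \<Rightarrow> nat \<Rightarrow> ('a, 'n) fform \<Rightarrow> bool" where
  "smooth_form_components A k \<omega> \<longleftrightarrow>
     (\<forall>c p. \<not> (c \<in> A \<and> p \<in> fst c) \<longrightarrow> \<omega> c p = (\<lambda>v. 0)) \<and>
     (\<forall>c\<in>A. \<forall>p\<in>fst c. alternating_form k (\<omega> c p)) \<and>
     (\<forall>c\<in>A. \<forall>v. smooth_on (\<lambda>x. \<omega> c (chart_inv c x) v) (snd c ` fst c))"

definition straight_forms :: "('a, 'n::finite) chart set \<Rightarrow> nat \<Rightarrow> ('a, 'n) fform set" where
  "straight_forms A k = {\<omega>. smooth_form_components A k \<omega> \<and>
     (\<forall>c\<in>A. \<forall>c'\<in>A. \<forall>p \<in> fst c \<inter> fst c'. \<forall>v.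
        \<omega> c p v = \<omega> c' p (\<lambda>i. transition_jacobian c c' p *v v i))}"

definition twisted_forms :: "('a, 'n::finite) chart set \<Rightarrow> nat \<Rightarrow> ('a, 'n) fform set" where
  "twisted_forms A k = {\<omega>. smooth_form_components A k \<omega> \<and>
     (\<forall>c\<in>A. \<forall>c'\<in>A. \<forall>p \<in> fst c \<inter> fst c'. \<forall>v.
        \<omega> c p v = sgn (det (transition_jacobian c c' p)) *
                    \<omega> c' p (\<lambda>i. transition_jacobian c c' p *v v i))}"

definition wedge :: "nat \<Rightarrow> nat \<Rightarrow> ('a, 'n) fform \<Rightarrow> ('a, 'n) fform \<Rightarrow> ('a, 'n) fform" where
  "wedge k l \<omega> \<eta> = (\<lambda>c p v.
     (\<Sum>\<sigma> | \<sigma> permutes {..<k + l}.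
        of_int (sign \<sigma>) * \<omega> c p (\<lambda>i. v (\<sigma> i)) * \<eta> c p (\<lambda>i. v (\<sigma> (k + i))))
     / (fact k * fact l))"

definition interior_product :: "('a, 'n) vfield \<Rightarrow> ('a, 'n) fform \<Rightarrow> ('a, 'n) fform" where
  "interior_product V \<omega> = (\<lambda>c p v. \<omega> c p (case_nat (V c p) v))"

definition metric_dot ::
  "('a, 'n::finite) mfield \<Rightarrow> ('a, 'n) vfield \<Rightarrow> ('a, 'n) vfield \<Rightarrow> ('a, 'n) chart \<Rightarrow> 'a \<Rightarrow> real" where
  "metric_dot g W V c p = W c p \<bullet> (g c p *v V c p)"

definition flat :: "('a, 'n::finite) mfield \<Rightarrow> ('a, 'n) vfield \<Rightarrow> ('a, 'n) fform" where
  "flat g V = (\<lambda>c p v. v 0 \<bullet> (g c p *v V c p))"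

text \<open>Position of a coordinate in the order of the index type; this order fixes the orientation
  of the coordinate space of a chart.\<close>

definition coord_index :: "'n::{finite,linorder} \<Rightarrow> nat" where
  "coord_index j = card {i. i < j}"

definition coord_frame :: "nat \<Rightarrow> (real, 'n::{finite,linorder}) vec" where
  "coord_frame m = (\<chi> j. if coord_index j = m then 1 else 0)"

definition volume_form :: "('a, 'n::{finite,linorder}) mfield \<Rightarrow> ('a, 'n) fform" where
  "volume_form g = (\<lambda>c p v. sqrt (det (g c p)) * det (\<chi> j. v (coord_index j)))"

definition scale_form ::
  "(('a, 'n) chart \<Rightarrow> 'a \<Rightarrow> real) \<Rightarrow> ('a, 'n) fform \<Rightarrow> ('a, 'n) fform" where
  "scale_form f \<omega> = (\<lambda>c p v. f c p * \<omega> c p v)"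


section \<open>Integration of twisted top-degree forms\<close>

text \<open>
  The coordinate density of a twisted \<open>n\<close>-form transforms with the absolute value of the
  Jacobian determinant, so it can be integrated chart by chart over a partition of the manifold
  into Borel pieces, each contained in a chart.  Convergence is absolute.  By the change of
  variables formula all partitions give the same result, and the definition asks for all of them.
\<close>

definition chart_partition ::
  "'a topology \<Rightarrow> ('a, 'n::finite) chart set \<Rightarrow> (('a, 'n) chart \<Rightarrow> 'a set) \<Rightarrow> bool" where
  "chart_partition M A B \<longleftrightarrow>
     (\<forall>c\<in>A. B c \<subseteq> fst c \<and> snd c ` B c \<in> sets borel) \<and>
     countable {c\<in>A. B c \<noteq> {}} \<and>
     disjoint_family_on B A \<and> (\<Union>c\<in>A. B c) = topspace M"

definition coord_density ::
  "('a, 'n::{finite,linorder}) fform \<Rightarrow> ('a, 'n) chart \<Rightarrow> (real, 'n) vec \<Rightarrow> real" where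
  "coord_density \<mu> c x = \<mu> c (chart_inv c x) coord_frame"

definition twisted_has_integral ::
  "'a topology \<Rightarrow> ('a, 'n::{finite,linorder}) chart set \<Rightarrow> ('a, 'n) fform \<Rightarrow> real \<Rightarrow> bool" where
  "twisted_has_integral M A \<mu> I \<longleftrightarrow> (\<forall>B. chart_partition M A B \<longrightarrow>
     (\<forall>c\<in>A. set_integrable lborel (snd c ` B c) (coord_density \<mu> c)) \<and>
     (\<lambda>c. LINT x:snd c ` B c|lborel. \<bar>coord_density \<mu> c x\<bar>) summable_on A \<and>
     ((\<lambda>c. LINT x:snd c ` B c|lborel. coord_density \<mu> c x) has_sum I) A)"

definition twisted_integrable ::
  "'a topology \<Rightarrow> ('a, 'n::{finite,linorder}) chart set \<Rightarrow> ('a, 'n) fform \<Rightarrow> bool" where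
  "twisted_integrable M A \<mu> \<longleftrightarrow> (\<exists>I. twisted_has_integral M A \<mu> I)"

definition twisted_integral ::
  "'a topology \<Rightarrow> ('a, 'n::{finite,linorder}) chart set \<Rightarrow> ('a, 'n) fform \<Rightarrow> real" where
  "twisted_integral M A \<mu> = (THE I. twisted_has_integral M A \<mu> I)"

text \<open>The pairing of a straight \<open>k\<close>-form with a twisted \<open>(n - k)\<close>-form.\<close>

definition pairing_converges ::
  "'a topology \<Rightarrow> ('a, 'n::{finite,linorder}) chart set \<Rightarrow> nat \<Rightarrow>
   ('a, 'n) fform \<Rightarrow> ('a, 'n) fform \<Rightarrow> bool" where
  "pairing_converges M A k \<omega> \<eta> \<longleftrightarrow> twisted_integrable M A (wedge k (CARD('n) - k) \<omega> \<eta>)"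

definition poincare_pairing ::
  "'a topology \<Rightarrow> ('a, 'n::{finite,linorder}) chart set \<Rightarrow> nat \<Rightarrow>
   ('a, 'n) fform \<Rightarrow> ('a, 'n) fform \<Rightarrow> real" where
  "poincare_pairing M A k \<omega> \<eta> = twisted_integral M A (wedge k (CARD('n) - k) \<omega> \<eta>)"


section \<open>Functional derivatives\<close>

text \<open>\<open>W\<close> is the variational derivative at \<open>V\<close> of the functional \<open>K\<close> on the space \<open>X\<close>
  of vector fields, normed by \<open>N\<close>.\<close>

definition has_variational_derivative ::
  "'a topology \<Rightarrow> ('a, 'n::{finite,linorder}) chart set \<Rightarrow> ('a, 'n) mfield \<Rightarrow>
   ('a, 'n) vfield set \<Rightarrow> (('a, 'n) vfield \<Rightarrow> real) \<Rightarrow>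
   (('a, 'n) vfield \<Rightarrow> real) \<Rightarrow> ('a, 'n) vfield \<Rightarrow> ('a, 'n) vfield \<Rightarrow> bool" where
  "has_variational_derivative M A g X N K V W \<longleftrightarrow>
     W \<in> X \<and>
     (\<exists>D. frechet_on X N K V D \<and>
        (\<forall>U\<in>X. twisted_integrable M A (scale_form (metric_dot g W U) (volume_form g)) \<and>
           D U = twisted_integral M A (scale_form (metric_dot g W U) (volume_form g))))"

text \<open>In the next two definitions \<open>S\<close>, normed by \<open>N\<close>, is the space of forms on which the
  functional \<open>F\<close> is defined (\<open>k\<close> is their degree), and \<open>S'\<close> is the space of forms of
  complementary degree and opposite parity in which the derivative is sought.\<close>

definition has_twisted_derivative ::
  "'a topology \<Rightarrow> ('a, 'n::{finite,linorder}) chart set \<Rightarrow> nat \<Rightarrow>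
   ('a, 'n) fform set \<Rightarrow> (('a, 'n) fform \<Rightarrow> real) \<Rightarrow> ('a, 'n) fform set \<Rightarrow>
   (('a, 'n) fform \<Rightarrow> real) \<Rightarrow> ('a, 'n) fform \<Rightarrow> ('a, 'n) fform \<Rightarrow> bool" where
  "has_twisted_derivative M A k S N S' F \<omega> \<zeta> \<longleftrightarrow>
     S \<subseteq> straight_forms A k \<and> S' \<subseteq> twisted_forms A (CARD('n) - k) \<and> \<zeta> \<in> S' \<and>
     (\<exists>D. frechet_on S N F \<omega> D \<and>
        (\<forall>\<eta>\<in>S. pairing_converges M A k \<eta> \<zeta> \<and> D \<eta> = poincare_pairing M A k \<eta> \<zeta>))"

definition has_twisted_derivative_tw ::
  "'a topology \<Rightarrow> ('a, 'n::{finite,linorder}) chart set \<Rightarrow> nat \<Rightarrow>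
   ('a, 'n) fform set \<Rightarrow> (('a, 'n) fform \<Rightarrow> real) \<Rightarrow> ('a, 'n) fform set \<Rightarrow>
   (('a, 'n) fform \<Rightarrow> real) \<Rightarrow> ('a, 'n) fform \<Rightarrow> ('a, 'n) fform \<Rightarrow> bool" where
  "has_twisted_derivative_tw M A k S N S' F \<omega> \<zeta> \<longleftrightarrow>
     S \<subseteq> twisted_forms A k \<and> S' \<subseteq> straight_forms A (CARD('n) - k) \<and> \<zeta> \<in> S' \<and>
     (\<exists>D. frechet_on S N F \<omega> D \<and>
        (\<forall>\<eta>\<in>S. pairing_converges M A (CARD('n) - k) \<zeta> \<eta> \<and>
           D \<eta> = poincare_pairing M A (CARD('n) - k) \<zeta> \<eta>))"

definition twisted_derivative where
  "twisted_derivative M A k S N S' F \<omega> = (THE \<zeta>. has_twisted_derivative M A k S N S' F \<omega> \<zeta>)"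

definition twisted_derivative_tw where
  "twisted_derivative_tw M A k S N S' F \<omega> = (THE \<zeta>. has_twisted_derivative_tw M A k S N S' F \<omega> \<zeta>)"

end

(* Evaluated on the coordinate frame, flat U \<and> i_W vol equals g(W, U) vol, which turns the integral
   defining the variational derivative into the Poincare pairing.  Both U \<mapsto> flat U and
   U \<mapsto> i_U vol are linear isomorphisms onto the forms of the respective type: the inverse of the
   first is Cramer's rule for the metric, and an (n-1)-form on R^n is v \<mapsto> det(z, v) for a unique z.
   Frechet derivatives are therefore transported along them.  A second derivative is of the form
   i_Z vol (or flat Z), and testing both with U = Z - W gives that the integral of |Z - W|^2 vol
   vanishes, hence Z = W by continuity; no bump functions are needed. *)

theory Submission
  imports Defs
begin

section \<open>Calculus of smooth maps\<close>

text \<open>Surjectivity of the two isomorphisms has to produce genuine vector fields: smooth in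
  every chart and with the right transformation law. Smoothness is read off explicit formulas,
  namely polynomials in the components of the form and of the metric times a real power of
  \<open>det g\<close>; this dictates the closure rules for sums, products, determinants and powers.
  The transformation law comes instead from nondegeneracy: positive definiteness for
  \<open>flat\<close>, injectivity of z \<mapsto> det(z, .) for the interior product. In the latter
  case the sign in the law of twisted forms turns the |det J| coming from sqrt(det g) into det J.
  Integrals are compared piece by piece within one partition, by equality of densities or, for
  uniqueness, by termwise inequality. In the second case the partition is chosen so that the whole
  domain of a given chart is one piece. The definitions quantify the Frechet derivative
  existentially, so uniqueness of the representing field also rests on uniqueness of the Frechet
  derivative.\<close>

lemma Ck_on_decSuc: "Ck_on (Suc k) f S \<Longrightarrow> Ck_on k f S"
proof (induction k arbitrary: f)
  case 0
  then obtain f' where "\<forall>x\<in>S. (f has_derivative f' x) (at x)" by auto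
  then have "\<forall>x\<in>S. isCont f x" by (blast intro: has_derivative_continuous)
  then show ?case by (simp add: continuous_at_imp_continuous_on)
next
  case (Suc k)
  then show ?case by (simp only: Ck_on.simps(2)) blast
qed

text \<open>Openness makes the derivative \<open>at x\<close> depend only on values in
  \<open>S\<close>. This serves fields defined by cases, where smoothness is visible only on the
  branch valid in the chart.\<close>

lemma Ck_on_cong:
  assumes "open S" "\<And>x. x \<in> S \<Longrightarrow> f x = h x" "Ck_on k f S"
  shows "Ck_on k h S"
proof (cases k)
  case 0
  then show ?thesis using assms by (auto cong: continuous_on_cong)
next
  case (Suc m)
  then obtain f' where f': "\<And>x. x \<in> S \<Longrightarrow> (f has_derivative f' x) (at x)"
    "\<And>v. Ck_on m (\<lambda>x. f' x v) S"
    using assms(3) by auto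
  have "(h has_derivative f' x) (at x)" if "x \<in> S" for x
    using has_derivative_transform_within_open[OF f'(1)[OF that] assms(1) that] assms(2) by auto
  then show ?thesis using f'(2) Suc by auto
qed

lemma Ck_on_const: "Ck_on k (\<lambda>x. c) S"
  by (induction k arbitrary: c) (auto intro!: exI[of _ "\<lambda>x v. 0"])

lemma Ck_on_add:
  assumes "Ck_on k f S" "Ck_on k h S"
  shows "Ck_on k (\<lambda>x. f x + h x) S"
  using assms
proof (induction k arbitrary: f h)
  case 0
  then show ?case by (auto intro: continuous_on_add)
next
  case (Suc k)
  obtain f' where "\<And>x. x \<in> S \<Longrightarrow> (f has_derivative f' x) (at x)" "\<And>v. Ck_on k (\<lambda>x. f' x v) S"
    using Suc.prems(1) by auto
  moreover obtain h' where "\<And>x. x \<in> S \<Longrightarrow> (h has_derivative h' x) (at x)" "\<And>v. Ck_on k (\<lambda>x. h' x v) S"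
    using Suc.prems(2) by auto
  ultimately show ?case
    using Suc.IH by (auto intro!: exI[of _ "\<lambda>x v. f' x v + h' x v"] has_derivative_add)
qed

lemma Ck_on_sum:
  assumes "\<And>i. i \<in> I \<Longrightarrow> Ck_on k (f i) S"
  shows "Ck_on k (\<lambda>x. \<Sum>i\<in>I. f i x) S"
  using assms by (induction I rule: infinite_finite_induct) (auto intro: Ck_on_const Ck_on_add)

lemma Ck_on_bounded_linear:
  assumes "bounded_linear T" "Ck_on k f S"
  shows "Ck_on k (\<lambda>x. T (f x)) S"
  using assms(2)
proof (induction k arbitrary: f)
  case 0
  then show ?case using bounded_linear.continuous_on[OF assms(1)] by auto
next
  case (Suc k)
  obtain f' where "\<And>x. x \<in> S \<Longrightarrow> (f has_derivative f' x) (at x)" "\<And>v. Ck_on k (\<lambda>x. f' x v) S"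
    using Suc.prems by auto
  then show ?case
    using Suc.IH by (auto intro!: exI[of _ "\<lambda>x v. T (f' x v)"] bounded_linear.has_derivative[OF assms(1)])
qed

lemma Ck_on_mult:
  fixes f h :: "'a::real_normed_vector \<Rightarrow> real"
  assumes "Ck_on k f S" "Ck_on k h S"
  shows "Ck_on k (\<lambda>x. f x * h x) S"
  using assms
proof (induction k arbitrary: f h)
  case 0
  then show ?case by (auto intro: continuous_on_mult)
next
  case (Suc k)
  obtain f' where f': "\<And>x. x \<in> S \<Longrightarrow> (f has_derivative f' x) (at x)" "\<And>v. Ck_on k (\<lambda>x. f' x v) S"
    using Suc.prems(1) by auto
  obtain h' where h': "\<And>x. x \<in> S \<Longrightarrow> (h has_derivative h' x) (at x)" "\<And>v. Ck_on k (\<lambda>x. h' x v) S"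
    using Suc.prems(2) by auto
  note d = f' h'
  have "((\<lambda>x. f x * h x) has_derivative (\<lambda>v. f x * h' x v + f' x v * h x)) (at x)" if "x \<in> S" for x
    using d that by (auto intro: has_derivative_mult)
  \<comment> \<open>Each product pairs a derivative, known only to order \<open>k\<close>, with an
    undifferentiated factor, which \<open>Ck_on_decSuc\<close> lowers from order
    \<open>Suc k\<close> to \<open>k\<close>.\<close>
  moreover have "Ck_on k (\<lambda>x. f x * h' x v + f' x v * h x) S" for v
    using Suc.IH[OF Ck_on_decSuc[OF Suc.prems(1)] d(4)] Suc.IH[OF d(2) Ck_on_decSuc[OF Suc.prems(2)]]
    by (rule Ck_on_add)
  ultimately show ?case
    by (simp only: Ck_on.simps(2)) (rule exI[of _ "\<lambda>x v. f x * h' x v + f' x v * h x"], auto)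
qed

lemma Ck_on_prod:
  fixes f :: "'i \<Rightarrow> 'a::real_normed_vector \<Rightarrow> real"
  assumes "\<And>i. i \<in> I \<Longrightarrow> Ck_on k (f i) S"
  shows "Ck_on k (\<lambda>x. \<Prod>i\<in>I. f i x) S"
  using assms by (induction I rule: infinite_finite_induct) (auto intro: Ck_on_const Ck_on_mult)

text \<open>Differentiation turns exponent \<open>a\<close> into \<open>a - 1\<close>, so the
  induction closes once the exponent is arbitrary. The instances \<open>-1\<close> and
  \<open>-1/2\<close> give the reciprocals of \<open>det g\<close> and of its square root.\<close>

lemma Ck_on_powr:
  fixes f :: "'a::real_normed_vector \<Rightarrow> real"
  assumes "Ck_on k f S" "\<And>x. x \<in> S \<Longrightarrow> 0 < f x"
  shows "Ck_on k (\<lambda>x. f x powr a) S"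
  using assms(1)
proof (induction k arbitrary: a)
  case 0
  then show ?case using assms(2) by (auto intro!: continuous_on_powr) (metis less_irrefl)
next
  case (Suc k)
  obtain f' where d: "\<And>x. x \<in> S \<Longrightarrow> (f has_derivative f' x) (at x)" "\<And>v. Ck_on k (\<lambda>x. f' x v) S"
    using Suc.prems by auto
  have "((\<lambda>x. f x powr a) has_derivative (\<lambda>v. (a * f x powr (a - 1)) * f' x v)) (at x)"
    if "x \<in> S" for x
    using has_derivative_compose[OF d(1)[OF that]
        has_real_derivative_powr[OF assms(2)[OF that], THEN has_field_derivative_imp_has_derivative]]
    by simp
  moreover have "Ck_on k (\<lambda>x. (a * f x powr (a - 1)) * f' x v) S" for v
    using Suc.IH[OF Ck_on_decSuc[OF Suc.prems]] d(2) by (intro Ck_on_mult Ck_on_const)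
  ultimately show ?case
    by (simp only: Ck_on.simps(2)) (rule exI[of _ "\<lambda>x v. (a * f x powr (a - 1)) * f' x v"], auto)
qed

lemma Ck_on_vec_nth: "Ck_on k f S \<Longrightarrow> Ck_on k (\<lambda>x. f x $ i) S"
  by (rule Ck_on_bounded_linear[OF bounded_linear_vec_nth])

lemma Ck_on_vec:
  fixes f :: "'a::real_normed_vector \<Rightarrow> real ^ 'n::finite"
  assumes "\<And>i. Ck_on k (\<lambda>x. f x $ i) S"
  shows "Ck_on k f S"
proof -
  have "Ck_on k (\<lambda>x. \<Sum>i\<in>UNIV. (f x $ i) *\<^sub>R (axis i 1 :: real ^ 'n)) S"
    using assms by (intro Ck_on_sum Ck_on_bounded_linear[OF bounded_linear_scaleR_left])
  moreover have "(\<Sum>i\<in>UNIV. (f x $ i) *\<^sub>R axis i 1) = f x" for x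
    using basis_expansion[of "f x"] by (simp add: scalar_mult_eq_scaleR)
  ultimately show ?thesis by (simp only:)
qed

lemma Ck_on_det:
  fixes G :: "'a::real_normed_vector \<Rightarrow> real ^ 'n::finite ^ 'n"
  assumes "\<And>i j. Ck_on k (\<lambda>x. G x $ i $ j) S"
  shows "Ck_on k (\<lambda>x. det (G x)) S"
  unfolding det_def using assms by (intro Ck_on_sum Ck_on_mult Ck_on_const Ck_on_prod)

lemma smooth_on_imp_continuous_on: "smooth_on f S \<Longrightarrow> continuous_on S f"
  unfolding smooth_on_def by (metis Ck_on.simps(1))


section \<open>Positive definite matrices\<close>

lemma det_neq_0_if_posdef:
  fixes P :: "real ^ 'n::finite ^ 'n"
  assumes "\<And>v. v \<noteq> 0 \<Longrightarrow> 0 < v \<bullet> (P *v v)"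
  shows "det P \<noteq> 0"
proof -
  have "inj ((*v) P)"
  proof (rule injI)
    fix x y assume "P *v x = P *v y"
    then have "(x - y) \<bullet> (P *v (x - y)) = 0" by (simp add: matrix_vector_mult_diff_distrib)
    then show "x = y" using assms[of "x - y"] by force
  qed
  then show ?thesis
    using det_nz_iff_inj[OF matrix_vector_mul_linear, of P] by simp
qed

(* The segment from the identity to P consists of positive definite matrices, so det does not
   vanish on it. *)
lemma det_pos_if_posdef:
  fixes P :: "real ^ 'n::finite ^ 'n"
  assumes "\<And>v. v \<noteq> 0 \<Longrightarrow> 0 < v \<bullet> (P *v v)"
  shows "0 < det P"
proof (rule ccontr)
  define Q where "Q t = (\<chi> i j. (1 - t) * (mat 1 :: real^'n^'n) $ i $ j + t * P $ i $ j)" for t :: real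
  assume "\<not> 0 < det P"
  moreover have "Q 0 = mat 1" "Q 1 = P" by (simp_all add: Q_def vec_eq_iff)
  moreover have "continuous_on {0..1} (\<lambda>t. det (Q t))"
    unfolding det_def Q_def by (auto intro!: continuous_intros)
  ultimately obtain t where t: "0 \<le> t" "t \<le> 1" "det (Q t) = 0"
    using IVT2'[of "\<lambda>t. det (Q t)" 1 0 0] by auto
  have "Q t *v v = (1 - t) *\<^sub>R v + t *\<^sub>R (P *v v)" for v
  proof -
    have "Q t = (1 - t) *\<^sub>R mat 1 + t *\<^sub>R P" by (simp add: Q_def vec_eq_iff)
    then show ?thesis
      by (simp add: matrix_vector_mult_add_rdistrib scaleR_matrix_vector_assoc[symmetric])
  qed
  moreover have "0 < (1 - t) * (v \<bullet> v) + t * (v \<bullet> (P *v v))" if "v \<noteq> 0" for v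
  \<comment> \<open>For \<open>t = 0\<close> the first summand is positive; otherwise the second one
    is, and the first is nonnegative because \<open>t\<close> is at most 1.\<close>
  proof (cases "t = 0")
    case False
    then show ?thesis using t assms[OF that] by (intro add_nonneg_pos mult_nonneg_nonneg mult_pos_pos) auto
  qed (use that in auto)
  ultimately have "\<And>v. v \<noteq> 0 \<Longrightarrow> 0 < v \<bullet> (Q t *v v)" by (simp add: inner_add_right)
  then show False using det_neq_0_if_posdef t(3) by blast
qed


section \<open>Alternating forms\<close>

lemma alternating_formD:
  assumes "alternating_form k \<alpha>"
  shows alternating_form_cong: "(\<And>i. i < k \<Longrightarrow> v i = w i) \<Longrightarrow> \<alpha> v = \<alpha> w"
    and alternating_form_linear: "i < k \<Longrightarrow> linear (\<lambda>x. \<alpha> (v(i := x)))"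
    and alternating_form_same:
      "i < k \<Longrightarrow> j < k \<Longrightarrow> i \<noteq> j \<Longrightarrow> v i = v j \<Longrightarrow> \<alpha> v = 0"
proof -
  note a = assms[unfolded alternating_form_def]
  note 1 = conjunct1[OF a] and 2 = conjunct1[OF conjunct2[OF a]] and 3 = conjunct2[OF conjunct2[OF a]]
  show "(\<And>i. i < k \<Longrightarrow> v i = w i) \<Longrightarrow> \<alpha> v = \<alpha> w" by (rule 1[rule_format])
  show "i < k \<Longrightarrow> linear (\<lambda>x. \<alpha> (v(i := x)))" by (rule 2[rule_format])
  show "i < k \<Longrightarrow> j < k \<Longrightarrow> i \<noteq> j \<Longrightarrow> v i = v j \<Longrightarrow> \<alpha> v = 0"
    using 3[rule_format, of i j v] by simp
qed

text \<open>Polarisation: with \<open>v i + v j\<close> in both slots the form vanishes, and so do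
  the two diagonal terms of the expansion; what remains is the sum of the two mixed terms.\<close>

lemma alternating_form_transpose:
  assumes a: "alternating_form k \<alpha>" and ij: "i < k" "j < k" "i \<noteq> j"
  shows "\<alpha> (v \<circ> Transposition.transpose i j) = - \<alpha> v"
proof -
  define f where "f x y = \<alpha> (v(i := x, j := y))" for x y
  have add: "f (x + y) z = f x z + f y z" "f z (x + y) = f z x + f z y" for x y z
    using linear_add[OF alternating_form_linear[OF a ij(1), of "v(j := z)"], of x y]
      linear_add[OF alternating_form_linear[OF a ij(2), of "v(i := z)"], of x y] ij(3)
    by (simp_all add: f_def fun_upd_twist)
  have "f x x = 0" for x
    unfolding f_def using ij by (intro alternating_form_same[OF a ij]) auto
  then have "f (v i) (v j) + f (v j) (v i) = 0"
    by (metis add add.left_neutral add.right_neutral)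
  moreover have "v \<circ> Transposition.transpose i j = v(i := v j, j := v i)"
    using ij(3) by (auto simp: fun_eq_iff Transposition.transpose_def)
  ultimately show ?thesis by (simp add: f_def)
qed

lemma alternating_form_permute:
  assumes a: "alternating_form k \<alpha>" and p: "\<sigma> permutes {..<k}"
  shows "\<alpha> (v \<circ> \<sigma>) = of_int (sign \<sigma>) * \<alpha> v"
  using finite_lessThan p
proof (induction rule: permutes_rev_induct)
  case id
  then show ?case by simp
next
  case (swap i j \<sigma>)
  have "\<alpha> (v \<circ> (\<sigma> \<circ> Transposition.transpose i j)) = - \<alpha> (v \<circ> \<sigma>)"
    using alternating_form_transpose[OF a, of i j "v \<circ> \<sigma>"] swap
    by (simp add: comp_assoc del: comp_apply)
  moreover have "sign (\<sigma> \<circ> Transposition.transpose i j) = - sign \<sigma>"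
    using swap(3,4) permutation_permutes finite_lessThan
    by (subst sign_compose) (auto simp: sign_swap_id permutation_swap_id)
  ultimately show ?case using swap.IH by (simp only: of_int_minus mult_minus_left)
qed

text \<open>Prefixing \<open>z\<close> moves slot \<open>i\<close> to slot \<open>Suc i\<close>, so
  every condition is the one for \<open>\<alpha>\<close> with shifted indices. This is the shape in
  which \<open>interior_product\<close> inserts its vector.\<close>

lemma alternating_form_case_nat:
  assumes a: "alternating_form (Suc k) \<alpha>"
  shows "alternating_form k (\<lambda>v. \<alpha> (case_nat z v))"
  unfolding alternating_form_def
proof (intro conjI allI impI)
  show "\<alpha> (case_nat z v) = \<alpha> (case_nat z w)" if "\<forall>i<k. v i = w i" for v w
    using that by (intro alternating_form_cong[OF a]) (auto split: nat.split)
  show "linear (\<lambda>x. \<alpha> (case_nat z (v(i := x))))" if "i < k" for v i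
  proof -
    have "case_nat z (v(i := x)) = (case_nat z v)(Suc i := x)" for x
      by (auto simp: fun_eq_iff split: nat.split)
    then show ?thesis using alternating_form_linear[OF a, of "Suc i"] that by simp
  qed
  show "\<alpha> (case_nat z v) = 0" if "i < k" "j < k" "i \<noteq> j \<and> v i = v j" for v i j
    using that by (intro alternating_form_same[OF a, of "Suc i" "Suc j"]) auto
qed

lemma alternating_form_case_nat_linear:
  assumes "alternating_form (Suc k) \<alpha>"
  shows "linear (\<lambda>z. \<alpha> (case_nat z v))"
proof -
  have "(case_nat 0 v)(0 := z) = case_nat z v" for z
    by (auto simp: fun_eq_iff split: nat.split)
  then show ?thesis using alternating_form_linear[OF assms, of 0 "case_nat 0 v"] by simp
qed

lemma alternating_form_diff:
  assumes "alternating_form k \<alpha>" "alternating_form k \<beta>"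
  shows "alternating_form k (\<lambda>v. \<alpha> v - \<beta> v)"
  unfolding alternating_form_def
proof (intro conjI allI impI)
  show "\<alpha> v - \<beta> v = \<alpha> w - \<beta> w" if "\<forall>i<k. v i = w i" for v w
    using that alternating_form_cong[OF assms(1), of v w] alternating_form_cong[OF assms(2), of v w] by simp
  show "linear (\<lambda>x. \<alpha> (v(i := x)) - \<beta> (v(i := x)))" if "i < k" for v i
    using that by (intro linear_compose_sub alternating_form_linear[OF assms(1)] alternating_form_linear[OF assms(2)])
  show "\<alpha> v - \<beta> v = 0" if "i < k" "j < k" "i \<noteq> j \<and> v i = v j" for v i j
    using that alternating_form_same[OF assms(1), of i j] alternating_form_same[OF assms(2), of i j] by simp
qed

subsection \<open>The coordinate frame\<close>

lemma coord_index_less_iff: "coord_index i < coord_index j \<longleftrightarrow> i < j"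
proof -
  have mono: "coord_index i < coord_index j" if "i < j" for i j :: 'a
    unfolding coord_index_def using that by (intro psubset_card_mono) auto
  then show ?thesis by (metis less_asym' less_irrefl linorder_neqE)
qed

lemma coord_index_eq_iff [simp]: "coord_index i = coord_index j \<longleftrightarrow> i = j"
  by (metis coord_index_less_iff less_irrefl linorder_neqE)

lemma bij_betw_coord_index:
  "bij_betw coord_index (UNIV :: 'n::{finite,linorder} set) {..<CARD('n)}"
proof -
  have "coord_index j < CARD('n)" for j :: 'n
    unfolding coord_index_def by (rule psubset_card_mono) auto
  moreover have inj: "inj (coord_index :: 'n \<Rightarrow> nat)" by (simp add: inj_def)
  ultimately have "range (coord_index :: 'n \<Rightarrow> nat) = {..<CARD('n)}"
    by (intro card_subset_eq) (auto simp: card_image)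
  then show ?thesis using inj by (simp add: bij_betw_def)
qed

lemma coord_index_less [simp]: "coord_index (j :: 'n::{finite,linorder}) < CARD('n)"
  using bij_betw_coord_index[where 'n='n] by (auto simp: bij_betw_def)

lemma coord_frame_coord_index [simp]: "coord_frame (coord_index j) = axis j 1"
  by (simp add: coord_frame_def axis_def vec_eq_iff eq_commute)

lemma inner_coord_frame:
  "coord_frame (coord_index j) \<bullet> v = v $ j"
  by (simp add: inner_axis')

lemma linear_coord_expansion:
  assumes "linear f"
  shows "f (x :: real ^ 'n::{finite,linorder}) = (\<Sum>j\<in>UNIV. x $ j * f (coord_frame (coord_index j)) :: real)"
proof -
  have "f x = f (\<Sum>j\<in>UNIV. x $ j *\<^sub>R axis j 1)"
    using basis_expansion[of x] by (simp add: scalar_mult_eq_scaleR)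
  then show ?thesis by (simp add: linear_sum[OF assms] linear_cmul[OF assms])
qed

text \<open>The Euclidean volume form: \<open>volume_form\<close> without its metric density. The
  arguments are the rows, sorted by the rank of the index.\<close>

definition det_form :: "(nat \<Rightarrow> (real, 'n::{finite,linorder}) vec) \<Rightarrow> real" where
  "det_form v = det (\<chi> j. v (coord_index j))"

lemma alternating_det_form: "alternating_form CARD('n) (det_form :: 'n::{finite,linorder} form)"
  unfolding alternating_form_def
proof (intro conjI allI impI)
  show "det_form v = det_form w" if "\<forall>i<CARD('n). v i = w i" for v w :: "nat \<Rightarrow> (real, 'n) vec"
    using that by (simp add: det_form_def)
  show "linear (\<lambda>x. det_form (v(i := x)))" if i: "i < CARD('n)" for v :: "nat \<Rightarrow> (real, 'n) vec" and i
  proof -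
    obtain a :: 'n where a: "i = coord_index a"
      using bij_betw_coord_index[where 'n='n] i by (metis bij_betw_iff_bijections lessThan_iff)
    have "det_form (v(i := x)) = det (\<chi> j. if j = a then x else v (coord_index j))" for x
      unfolding det_form_def a by (intro arg_cong[where f=det]) (simp add: vec_eq_iff)
    then show ?thesis
      using det_row_add[of a "\<lambda>_. _" "\<lambda>_. _" "\<lambda>j. v (coord_index j)"]
        det_row_mul[of a _ "\<lambda>_. _" "\<lambda>j. v (coord_index j)", unfolded scalar_mult_eq_scaleR]
      by (auto intro!: linearI)
  qed
  show "det_form v = 0" if ij: "i < CARD('n)" "j < CARD('n)" "i \<noteq> j \<and> v i = v j"
    for v :: "nat \<Rightarrow> (real, 'n) vec" and i j
  proof -
    obtain a b :: 'n where "i = coord_index a" "j = coord_index b"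
      using bij_betw_coord_index[where 'n='n] ij by (metis bij_betw_iff_bijections lessThan_iff)
    then show ?thesis
      unfolding det_form_def using ij by (intro det_identical_rows[of a b]) (auto simp: row_def vec_eq_iff)
  qed
qed

lemma det_form_coord_frame [simp]: "det_form coord_frame = 1"
proof -
  have "(\<chi> j. coord_frame (coord_index j)) = (mat 1 :: ((real, 'a) vec, 'a) vec)"
    by (simp add: vec_eq_iff axis_def mat_def eq_commute)
  then show ?thesis by (simp add: det_form_def)
qed

text \<open>As the arguments are rows, applying \<open>J\<close> to each of them is right
  multiplication by \<open>transpose J\<close>.\<close>

lemma det_form_matrix_vector_mult:
  fixes v :: "nat \<Rightarrow> real ^ 'n::{finite,linorder}"
  shows "det_form (\<lambda>i. J *v v i) = det J * det_form v"
proof -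
  have "(\<chi> j :: 'n. J *v v (coord_index j)) = (\<chi> j :: 'n. v (coord_index j)) ** transpose J"
    by (simp add: vec_eq_iff matrix_matrix_mult_def matrix_vector_mult_def transpose_def mult.commute)
  then show ?thesis by (simp only: det_form_def det_mul det_transpose mult.commute)
qed

text \<open>Index types are nonempty, so the truncated subtraction is harmless:
  \<open>Suc (CARD('n) - 1) = CARD('n)\<close>.\<close>

lemma alternating_det_form_case_nat:
  "alternating_form (CARD('n) - 1) (\<lambda>v. det_form (case_nat (z :: real ^ 'n::{finite,linorder}) v))"
  using alternating_form_case_nat[of "CARD('n) - 1" det_form z] alternating_det_form[where 'n='n]
  by simp

lemma linear_det_form_case_nat:
  "linear (\<lambda>z :: real ^ 'n::{finite,linorder}. det_form (case_nat z v))"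
  using alternating_form_case_nat_linear[of "CARD('n) - 1" det_form v] alternating_det_form[where 'n='n]
  by simp

text \<open>Multilinearity reduces arbitrary arguments to frame vectors, one slot at a time, and a
  tuple with a repeated frame vector is killed by alternation; only injective tuples are left to
  check.\<close>

lemma alternating_form_eq_0_on_frame:
  fixes \<alpha> :: "'n::{finite,linorder} form"
  assumes a: "alternating_form k \<alpha>"
    and zero: "\<And>f. f ` {..<k} \<subseteq> {..<CARD('n)} \<Longrightarrow> inj_on f {..<k} \<Longrightarrow> \<alpha> (coord_frame \<circ> f) = 0"
  shows "\<alpha> v = 0"
proof -
  \<comment> \<open>Here \<open>j\<close> counts the leading slots that are still arbitrary; the
    slots from \<open>j\<close> on already hold frame vectors.\<close>
  have "\<alpha> v = 0" if "j \<le> k" "\<And>i. j \<le> i \<Longrightarrow> i < k \<Longrightarrow> v i \<in> coord_frame ` {..<CARD('n)}" for j v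
    using that
  proof (induction j arbitrary: v)
    case 0
    then have "\<forall>i\<in>{..<k}. \<exists>m\<in>{..<CARD('n)}. v i = coord_frame m" by blast
    then obtain f where f: "\<And>i. i < k \<Longrightarrow> f i < CARD('n) \<and> v i = coord_frame (f i)"
      by (metis lessThan_iff)
    have eq: "\<alpha> v = \<alpha> (coord_frame \<circ> f)" using f by (intro alternating_form_cong[OF a]) auto
    show ?case
    proof (cases "inj_on f {..<k}")
      case True
      then show ?thesis using zero[of f] f eq by auto
    next
      case False
      then obtain i j where "i < k" "j < k" "i \<noteq> j" "f i = f j" by (auto simp: inj_on_def)
      then show ?thesis unfolding eq by (intro alternating_form_same[OF a, of i j]) auto
    qed
  next
    case (Suc j)
    have lin: "linear (\<lambda>x. \<alpha> (v(j := x)))" using alternating_form_linear[OF a] Suc.prems by auto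
    have "\<alpha> (v(j := coord_frame (coord_index m))) = 0" for m :: 'n
      using Suc.prems coord_index_less[of m] by (intro Suc.IH) (auto simp del: coord_frame_coord_index coord_index_less)
    then show ?case using linear_coord_expansion[OF lin, of "v j"] by (simp del: coord_frame_coord_index)
  qed
  from this[of k v] show ?thesis by simp
qed

section \<open>Forms of degree n - 1 as determinants with a fixed first vector\<close>

lemma permutes_eq_comp:
  assumes "bij_betw f {..<k} B" "bij_betw h {..<k} B"
  obtains \<sigma> where "\<sigma> permutes {..<k}" "\<And>i. i < k \<Longrightarrow> f i = h (\<sigma> i)"
proof -
  \<comment> \<open>The change of enumeration, continued by the identity outside
    \<open>{..<k}\<close> as \<open>permutes\<close> requires.\<close>
  define \<sigma> where "\<sigma> = restrict_id (inv_into {..<k} h \<circ> f) {..<k}"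
  have "bij_betw (inv_into {..<k} h \<circ> f) {..<k} {..<k}"
    by (rule bij_betw_trans[OF assms(1) bij_betw_inv_into[OF assms(2)]])
  then have "\<sigma> permutes {..<k}" unfolding \<sigma>_def by (rule permutes_restrict_id)
  moreover have "f i = h (\<sigma> i)" if "i < k" for i
    using that assms bij_betw_apply[OF assms(1), of i] by (simp add: \<sigma>_def bij_betw_inv_into_right)
  ultimately show thesis using that by blast
qed

(* The coordinate vectors other than the m-th one, listed so that prefixing the m-th vector gives
   a permutation of the frame. *)
definition coframe :: "nat \<Rightarrow> nat \<Rightarrow> (real, 'n::{finite,linorder}) vec" where
  "coframe m = (\<lambda>i. coord_frame (Transposition.transpose 0 m (Suc i)))"

text \<open>The sign of moving the \<open>m\<close>-th vector to the front: 1 for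
  \<open>m = 0\<close>, where the transposition is the identity, and -1 otherwise. In particular it
  is its own inverse.\<close>

definition coframe_sign :: "nat \<Rightarrow> real" where
  "coframe_sign m = of_int (sign (Transposition.transpose 0 m))"

lemma coframe_sign_square [simp]: "coframe_sign m * (coframe_sign m * x) = x"
  by (simp add: coframe_sign_def sign_swap_id)

text \<open>Shows that \<open>coframe m\<close> runs exactly once through the frame indices other
  than \<open>m\<close>: \<open>Suc\<close> skips 0, and the transposition moves the gap from 0 to
  \<open>m\<close>.\<close>

lemma bij_betw_transpose_Suc:
  assumes "m < n"
  shows "bij_betw (\<lambda>i. Transposition.transpose 0 m (Suc i)) {..<n - 1} ({..<n} - {m})"
proof -
  have "bij_betw Suc {..<n - 1} ({..<n} - {0})"
    using assms by (intro bij_betw_byWitness[of _ "\<lambda>i. i - 1"]) auto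
  moreover have "bij_betw (Transposition.transpose 0 m) ({..<n} - {0}) ({..<n} - {m})"
    using assms by (intro bij_betw_byWitness[of _ "Transposition.transpose 0 m"]) (auto simp: Transposition.transpose_def)
  ultimately show ?thesis using bij_betw_trans[of Suc _ _ "Transposition.transpose 0 m"] by (simp add: comp_def)
qed

text \<open>For \<open>z\<close> a frame vector, either the prefixed coframe is a permuted frame, or
  \<open>z\<close> already occurs in it and the determinant vanishes. By linearity the coframes read
  off the components of \<open>z\<close> up to sign.\<close>

lemma det_form_coframe:
  fixes z :: "real ^ 'n::{finite,linorder}"
  shows "det_form (case_nat z (coframe (coord_index a))) = coframe_sign (coord_index a) * z $ a"
proof -
  let ?m = "coord_index a"
  have 1: "det_form (case_nat (coord_frame (coord_index b) :: (real, 'n) vec) (coframe ?m)) =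
      (if b = a then coframe_sign ?m else 0)" for b :: 'n
  proof (cases "b = a")
    case True
    have eq: "case_nat (coord_frame ?m :: (real, 'n) vec) (coframe ?m) = coord_frame \<circ> Transposition.transpose 0 ?m"
    proof (rule ext)
      show "case_nat (coord_frame ?m) (coframe ?m) i = (coord_frame \<circ> Transposition.transpose 0 ?m) i" for i
        by (cases i) (simp_all add: coframe_def del: coord_frame_coord_index)
    qed
    have p: "Transposition.transpose 0 ?m permutes {..<CARD('n)}"
      by (intro permutes_swap_id) simp_all
    have "det_form ((coord_frame :: nat \<Rightarrow> (real, 'n) vec) \<circ> Transposition.transpose 0 ?m) =
        of_int (sign (Transposition.transpose 0 ?m)) * det_form (coord_frame :: nat \<Rightarrow> (real, 'n) vec)"
      by (rule alternating_form_permute[OF alternating_det_form p])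
    then show ?thesis
      by (simp only: True eq if_True simp_thms coframe_sign_def det_form_coord_frame mult_1_right)
  next
    case False
    then have "coord_index b \<in> {..<CARD('n)} - {?m}" by simp
    then have "coord_index b \<in> (\<lambda>i. Transposition.transpose 0 ?m (Suc i)) ` {..<CARD('n) - 1}"
      using bij_betw_imp_surj_on[OF bij_betw_transpose_Suc[OF coord_index_less[of a]]] by simp
    then obtain i where i: "i \<in> {..<CARD('n) - 1}"
      "coord_index b = Transposition.transpose 0 ?m (Suc i)"
      by (rule imageE)
    have "case_nat (coord_frame (coord_index b)) (coframe ?m) 0 =
        (case_nat (coord_frame (coord_index b)) (coframe ?m) (Suc i) :: (real, 'n) vec)"
      by (simp only: coframe_def i(2) nat.case)
    then have "det_form (case_nat (coord_frame (coord_index b) :: (real, 'n) vec) (coframe ?m)) = 0"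
      using i(1) by (intro alternating_form_same[OF alternating_det_form, of 0 "Suc i"]) simp_all
    then show ?thesis using False by simp
  qed
  have "det_form (case_nat z (coframe ?m)) =
      (\<Sum>j\<in>UNIV. z $ j * det_form (case_nat (coord_frame (coord_index j) :: (real, 'n) vec) (coframe ?m)))"
    by (rule linear_coord_expansion[OF linear_det_form_case_nat])
  also have "\<dots> = (\<Sum>j\<in>UNIV. if j = a then coframe_sign ?m * z $ j else 0)"
    by (intro sum.cong refl) (simp add: 1 mult.commute del: coord_frame_coord_index)
  also have "\<dots> = coframe_sign ?m * z $ a" by simp
  finally show ?thesis .
qed

text \<open>An injective tuple of n - 1 frame vectors misses exactly one index \<open>m\<close>,
  hence is a permutation of \<open>coframe m\<close>; the \<open>m\<close>-th component of the
  prefixed vector is chosen to make both sides agree there. Its explicit formula later yields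
  smoothness.\<close>

lemma alternating_form_codegree_1:
  fixes \<beta> :: "'n::{finite,linorder} form"
  assumes b: "alternating_form (CARD('n) - 1) \<beta>"
  shows "\<beta> v = det_form (case_nat (\<chi> a. coframe_sign (coord_index a) * \<beta> (coframe (coord_index a))) v)"
proof -
  let ?z = "\<chi> a. coframe_sign (coord_index a) * \<beta> (coframe (coord_index a))"
  define \<gamma> where "\<gamma> v = \<beta> v - det_form (case_nat ?z v)" for v
  have g: "alternating_form (CARD('n) - 1) \<gamma>"
    unfolding \<gamma>_def by (rule alternating_form_diff[OF b alternating_det_form_case_nat])
  have "\<gamma> v = 0"
  proof (rule alternating_form_eq_0_on_frame[OF g])
    fix f assume f: "f ` {..<CARD('n) - 1} \<subseteq> {..<CARD('n)}" "inj_on f {..<CARD('n) - 1}"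
    have "card ({..<CARD('n)} - f ` {..<CARD('n) - 1}) = 1"
      using f by (simp add: card_Diff_subset card_image)
    then obtain m where m: "{..<CARD('n)} - f ` {..<CARD('n) - 1} = {m}" by (rule card_1_singletonE)
    then have "m < CARD('n)" by auto
    then obtain a :: 'n where a: "m = coord_index a"
      using bij_betw_coord_index[where 'n='n] by (metis bij_betw_iff_bijections lessThan_iff)
    have "f ` {..<CARD('n) - 1} = {..<CARD('n)} - {m}" using f(1) m by blast
    then have bij: "bij_betw f {..<CARD('n) - 1} ({..<CARD('n)} - {m})"
      unfolding bij_betw_def using f(2) by simp
    obtain \<sigma> where s: "\<sigma> permutes {..<CARD('n) - 1}"
      "\<And>i. i < CARD('n) - 1 \<Longrightarrow> f i = Transposition.transpose 0 m (Suc (\<sigma> i))"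
      using permutes_eq_comp[OF bij bij_betw_transpose_Suc[OF \<open>m < CARD('n)\<close>]] by blast
    have zero: "\<gamma> (coframe m) = 0" by (simp add: \<gamma>_def a det_form_coframe)
    have "\<gamma> (coord_frame \<circ> f) = \<gamma> (coframe m \<circ> \<sigma>)"
      using s(2) by (intro alternating_form_cong[OF g]) (simp add: coframe_def)
    also have "\<dots> = of_int (sign \<sigma>) * \<gamma> (coframe m)"
      by (rule alternating_form_permute[OF g s(1)])
    also have "\<dots> = 0" unfolding zero by simp
    finally show "\<gamma> (coord_frame \<circ> f) = 0" .
  qed
  then show ?thesis by (simp add: \<gamma>_def)
qed

lemma det_form_case_nat_inject:
  fixes y z :: "real ^ 'n::{finite,linorder}"
  assumes "\<And>v. det_form (case_nat y v) = det_form (case_nat z v)"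
  shows "y = z"
proof -
  have "coframe_sign (coord_index a) * y $ a = coframe_sign (coord_index a) * z $ a" for a
    using assms[of "coframe (coord_index a)"] by (simp add: det_form_coframe)
  then show ?thesis by (metis coframe_sign_square vec_eq_iff)
qed

section \<open>Wedge product of a 1-form with an (n-1)-form\<close>

lemma sum_permutes_eq_fact:
  assumes "0 < n"
  shows "(\<Sum>\<sigma> | \<sigma> permutes {..<n}. h (\<sigma> 0)) = fact (n - 1) * (\<Sum>i<n. h i :: real)"
proof -
  have eq: "{..<n} = insert 0 {1..<n}" using assms by auto
  have "(\<Sum>\<sigma> | \<sigma> permutes {..<n}. h (\<sigma> 0)) =
      (\<Sum>b\<in>insert 0 {1..<n}. \<Sum>q | q permutes {1..<n}. h ((Transposition.transpose 0 b \<circ> q) 0))"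
    unfolding eq by (rule sum_over_permutations_insert) auto
  also have "\<dots> = (\<Sum>b\<in>insert 0 {1..<n}. \<Sum>q | q permutes {1..<n}. h b)"
  proof (intro sum.cong refl)
    \<comment> \<open>The permutations with value \<open>b\<close> at 0 are parametrised by
      permutations \<open>q\<close> of the remaining indices, which fix 0; there are (n-1)! of them
      for each \<open>b\<close>.\<close>
    fix b q assume "q \<in> {q. q permutes {1..<n}}"
    then have "q 0 = 0" by (auto intro: permutes_not_in)
    then show "h ((Transposition.transpose 0 b \<circ> q) 0) = h b" by simp
  qed
  also have "\<dots> = fact (n - 1) * (\<Sum>i<n. h i)"
    unfolding eq by (simp add: card_permutations[of _ "n - 1"] sum_distrib_left distrib_left)
  finally show ?thesis .
qed

text \<open>After reordering the determinant the two signs cancel and each summand depends on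
  \<open>\<sigma> 0\<close> alone. Each value of \<open>\<sigma> 0\<close> occurs (n-1)! times,
  which is the normalising factorial of \<open>wedge\<close>.\<close>

lemma wedge_1_det_form:
  fixes z :: "real ^ 'n::{finite,linorder}" and f :: "(real, 'n) vec \<Rightarrow> real"
  shows "(\<Sum>\<sigma> | \<sigma> permutes {..<CARD('n)}. of_int (sign \<sigma>) * f (coord_frame (\<sigma> 0)) *
            det_form (case_nat z (\<lambda>i. coord_frame (\<sigma> (Suc i))))) / fact (CARD('n) - 1)
         = (\<Sum>j\<in>UNIV. f (coord_frame (coord_index j)) * z $ j)"
proof -
  let ?h = "\<lambda>m. f (coord_frame m) * det_form (coord_frame(m := z))"
  have d: "det_form (coord_frame(coord_index j := z)) = z $ j" for j :: 'n
  proof -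
    have "det_form (coord_frame(coord_index j := coord_frame (coord_index i) :: (real, 'n) vec)) =
       (if i = j then 1 else 0)" for i :: 'n
    proof (cases "i = j")
      case False
      then show ?thesis
        using alternating_form_same[OF alternating_det_form, of "coord_index i" "coord_index j"
            "coord_frame(coord_index j := coord_frame (coord_index i) :: (real, 'n) vec)"]
        by (simp del: coord_frame_coord_index)
    qed (simp add: fun_upd_triv del: coord_frame_coord_index)
    note 1 = this
    have lin: "linear (\<lambda>x :: (real, 'n) vec. det_form (coord_frame(coord_index j := x)))"
      by (rule alternating_form_linear[OF alternating_det_form coord_index_less])
    have "det_form (coord_frame(coord_index j := z)) =
        (\<Sum>i\<in>UNIV. z $ i * det_form (coord_frame(coord_index j := (coord_frame (coord_index i) :: (real, 'n) vec))))"
      by (rule linear_coord_expansion[OF lin])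
    also have "\<dots> = (\<Sum>i\<in>UNIV. if i = j then z $ i else 0)"
      by (intro sum.cong refl) (simp add: 1 del: coord_frame_coord_index)
    finally show ?thesis by simp
  qed
  have "of_int (sign \<sigma>) * f (coord_frame (\<sigma> 0)) * det_form (case_nat z (\<lambda>i. coord_frame (\<sigma> (Suc i))))
      = ?h (\<sigma> 0)" if s: "\<sigma> permutes {..<CARD('n)}" for \<sigma>
  proof -
    \<comment> \<open>Putting \<open>z\<close> first and then following \<open>\<sigma>\<close> is
      the same as replacing the frame vector at position \<open>\<sigma> 0\<close> by
      \<open>z\<close> and permuting by \<open>\<sigma>\<close>; injectivity of
      \<open>\<sigma>\<close> keeps the later entries unchanged.\<close>
    have "case_nat z (\<lambda>i. coord_frame (\<sigma> (Suc i))) = coord_frame(\<sigma> 0 := z) \<circ> \<sigma>"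
      using permutes_inj[OF s] by (auto simp: fun_eq_iff inj_eq split: nat.split)
    then have "det_form (case_nat z (\<lambda>i. coord_frame (\<sigma> (Suc i))))
        = of_int (sign \<sigma>) * det_form (coord_frame(\<sigma> 0 := z))"
      using alternating_form_permute[OF alternating_det_form s] by simp
    moreover have "of_int (sign \<sigma>) * (of_int (sign \<sigma>) * x) = x" for x :: real
      by (simp add: sign_def)
    ultimately show ?thesis by (simp add: mult.assoc mult.left_commute)
  qed
  then have "(\<Sum>\<sigma> | \<sigma> permutes {..<CARD('n)}. of_int (sign \<sigma>) * f (coord_frame (\<sigma> 0)) *
            det_form (case_nat z (\<lambda>i. coord_frame (\<sigma> (Suc i)))))
      = (\<Sum>\<sigma> | \<sigma> permutes {..<CARD('n)}. ?h (\<sigma> 0))" by (intro sum.cong) auto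
  also have "\<dots> = fact (CARD('n) - 1) * (\<Sum>m<CARD('n). ?h m)"
    by (rule sum_permutes_eq_fact) simp
  also have "(\<Sum>m<CARD('n). ?h m) = (\<Sum>j::'n\<in>UNIV. ?h (coord_index j))"
    by (rule sum.reindex_bij_betw[OF bij_betw_coord_index, symmetric])
  also have "(\<Sum>j::'n\<in>UNIV. ?h (coord_index j)) = (\<Sum>j\<in>UNIV. f (coord_frame (coord_index j)) * z $ j)"
    unfolding d ..
  finally show ?thesis by simp
qed


section \<open>Charts and the metric\<close>

context
  fixes M :: "'a topology" and A :: "('a, 'n::finite) chart set"
  assumes M: "smooth_manifold M A"
begin

lemma smooth_manifoldD:
  assumes "c \<in> A"
  shows openin_chart: "openin M (fst c)"
    and open_chart_image: "open (snd c ` fst c)"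
    and homeomorphic_chart:
      "homeomorphic_map (subtopology M (fst c)) (top_of_set (snd c ` fst c)) (snd c)"
  using M assms unfolding smooth_manifold_def by auto

lemma Union_charts: "(\<Union>c\<in>A. fst c) = topspace M"
  using M unfolding smooth_manifold_def by auto

lemma inj_on_chart:
  assumes "c \<in> A"
  shows "inj_on (snd c) (fst c)"
proof -
  have "fst c \<subseteq> topspace M" using openin_chart[OF assms] by (rule openin_subset)
  then show ?thesis
    using homeomorphic_imp_injective_map[OF homeomorphic_chart[OF assms]]
    by (simp add: Int_absorb1)
qed

lemma chart_inv_chart: "c \<in> A \<Longrightarrow> p \<in> fst c \<Longrightarrow> chart_inv c (snd c p) = p"
  unfolding chart_inv_def by (rule inv_into_f_f[OF inj_on_chart])

lemma open_chart_image_Int: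
  assumes "c \<in> A" "openin M U"
  shows "open (snd c ` (fst c \<inter> U))"
proof -
  have "openin (subtopology M (fst c)) (fst c \<inter> U)"
    using assms(2) by (auto simp: openin_subtopology)
  then have "openin (top_of_set (snd c ` fst c)) (snd c ` (fst c \<inter> U))"
    using homeomorphic_imp_open_map[OF homeomorphic_chart[OF assms(1)]] unfolding open_map_def by blast
  then show ?thesis
    using open_chart_image[OF assms(1)] openin_open_trans by blast
qed

end

lemma chart_inv_mem: "x \<in> snd c ` fst c \<Longrightarrow> chart_inv c x \<in> fst c"
  unfolding chart_inv_def by (rule inv_into_into)

lemma inner_transpose_matrix:
  fixes J :: "real ^ 'n::finite ^ 'm::finite"
  shows "x \<bullet> (transpose J *v w) = (J *v x) \<bullet> w"
  by (metis dot_lmul_matrix inner_commute transpose_matrix_vector)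

lemma matrix_vector_surj:
  fixes J :: "real ^ 'n::finite ^ 'n"
  assumes "det J \<noteq> 0"
  obtains x where "J *v x = y"
  using cramer[OF assms] by blast

context
  fixes A :: "('a, 'n::finite) chart set" and g :: "('a, 'n) mfield"
  assumes g: "riemannian_metric A g"
begin

lemma metric_smooth: "c \<in> A \<Longrightarrow> smooth_on (\<lambda>x. g c (chart_inv c x)) (snd c ` fst c)"
  using g unfolding riemannian_metric_def by blast

lemma metric_outside: "\<not> (c \<in> A \<and> p \<in> fst c) \<Longrightarrow> g c p = 0"
  using g unfolding riemannian_metric_def by blast

lemma metric_pos: "c \<in> A \<Longrightarrow> p \<in> fst c \<Longrightarrow> v \<noteq> 0 \<Longrightarrow> 0 < v \<bullet> (g c p *v v)"
  using g unfolding riemannian_metric_def by blast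

text \<open>Outside the chart domains the metric is zero and hence symmetric too. This makes the
  symmetry of \<open>metric_dot\<close> an equality of functions, usable for rewriting inside
  integrals.\<close>

lemma metric_symmetric: "transpose (g c p) = g c p"
proof (cases "c \<in> A \<and> p \<in> fst c")
  case True
  then show ?thesis using g unfolding riemannian_metric_def by blast
next
  case False
  then show ?thesis by (simp add: metric_outside transpose_def vec_eq_iff)
qed

lemma metric_dot_commute: "metric_dot g U W c p = metric_dot g W U c p"
  using inner_transpose_matrix[of "U c p" "g c p" "W c p"]
  by (simp add: metric_dot_def metric_symmetric inner_commute)

lemma metric_dot_pos: "c \<in> A \<Longrightarrow> p \<in> fst c \<Longrightarrow> U c p \<noteq> 0 \<Longrightarrow> 0 < metric_dot g U U c p"
  unfolding metric_dot_def by (rule metric_pos)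

lemma det_metric_pos: "c \<in> A \<Longrightarrow> p \<in> fst c \<Longrightarrow> 0 < det (g c p)"
  by (intro det_pos_if_posdef metric_pos)

lemma metric_transition:
  "c \<in> A \<Longrightarrow> c' \<in> A \<Longrightarrow> p \<in> fst c \<inter> fst c' \<Longrightarrow>
    g c p = transpose (transition_jacobian c c' p) ** g c' p ** transition_jacobian c c' p"
  using g unfolding riemannian_metric_def by blast

lemma det_metric_transition:
  assumes "c \<in> A" "c' \<in> A" "p \<in> fst c \<inter> fst c'"
  shows "det (g c p) = (det (transition_jacobian c c' p))\<^sup>2 * det (g c' p)"
  by (simp add: metric_transition[OF assms] det_mul det_transpose power2_eq_square)

text \<open>The squared Jacobian determinant is a factor of the positive number
  \<open>det (g c p)\<close>.\<close>

lemma det_transition_neq_0: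
  assumes "c \<in> A" "c' \<in> A" "p \<in> fst c \<inter> fst c'"
  shows "det (transition_jacobian c c' p) \<noteq> 0"
  using det_metric_transition[OF assms] det_metric_pos[of c p] assms by auto

lemma Ck_on_metric_det:
  "c \<in> A \<Longrightarrow> Ck_on k (\<lambda>x. det (g c (chart_inv c x))) (snd c ` fst c)"
  using metric_smooth unfolding smooth_on_def by (intro Ck_on_det Ck_on_vec_nth) simp

end


section \<open>The isomorphisms of vector fields with forms\<close>

lemma flat_surj:
  fixes A :: "('a, 'n::{finite,linorder}) chart set"
  assumes M: "smooth_manifold M A" and g: "riemannian_metric A g" and \<eta>: "\<eta> \<in> straight_forms A 1"
  obtains U where "U \<in> vector_fields A" "flat g U = \<eta>"
proof -
  define a where "a c p = (\<chi> j. \<eta> c p (\<lambda>_. axis j 1))" for c p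
  \<comment> \<open>The numerator matrix of Cramer's rule: column \<open>k\<close> of the metric is
    replaced by the components \<open>a\<close> of the form.\<close>
  define G where "G c p k = (\<chi> i j. if j = k then a c p $ i else g c p $ i $ j)" for c p k
  \<comment> \<open>The denominator is written as a power so that \<open>Ck_on_powr\<close>
    applies.\<close>
  define U where "U c p = (if c \<in> A \<and> p \<in> fst c then \<chi> k. det (G c p k) * det (g c p) powr (-1) else 0)"
    for c p
  have alt: "alternating_form 1 (\<eta> c p)" if "c \<in> A" "p \<in> fst c" for c p
    using \<eta> that unfolding straight_forms_def smooth_form_components_def by blast
  have smooth: "Ck_on k (\<lambda>x. \<eta> c (chart_inv c x) v) (snd c ` fst c)" if "c \<in> A" for c k v
    using \<eta> that unfolding straight_forms_def smooth_form_components_def smooth_on_def by blast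
  have outside: "\<eta> c p = (\<lambda>v. 0)" if "\<not> (c \<in> A \<and> p \<in> fst c)" for c p
    using \<eta> that unfolding straight_forms_def smooth_form_components_def by blast
  have trans: "\<eta> c p v = \<eta> c' p (\<lambda>i. transition_jacobian c c' p *v v i)"
    if "c \<in> A" "c' \<in> A" "p \<in> fst c \<inter> fst c'" for c c' p v
    using \<eta> that unfolding straight_forms_def by blast
  have gU: "g c p *v U c p = a c p" if "c \<in> A" "p \<in> fst c" for c p
  proof -
    have d: "0 < det (g c p)" by (rule det_metric_pos[OF g that])
    have "U c p = (\<chi> k. det (G c p k) / det (g c p))"
      using that d by (simp add: U_def powr_minus_divide vec_eq_iff)
    then show ?thesis using d by (subst cramer) (simp_all add: G_def)
  qed
  have \<eta>_eq: "\<eta> c p v = v 0 \<bullet> a c p" if "c \<in> A" "p \<in> fst c" for c p v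
  proof -
    have const: "\<eta> c p (u(0 := x)) = \<eta> c p (\<lambda>_. x)" for u x
      by (rule alternating_form_cong[OF alt[OF that]]) simp
    have "linear (\<lambda>x. \<eta> c p (\<lambda>_. x))"
      using alternating_form_linear[OF alt[OF that], of 0] unfolding const by simp
    from linear_coord_expansion[OF this, of "v 0"] have "\<eta> c p (\<lambda>_. v 0) = v 0 \<bullet> a c p"
      by (simp add: inner_vec_def a_def)
    then show ?thesis using const[of v "v 0"] by simp
  qed
  have "flat g U c p v = \<eta> c p v" for c p v
  proof (cases "c \<in> A \<and> p \<in> fst c")
    case True
    then show ?thesis using \<eta>_eq gU by (simp add: flat_def)
  next
    case False
    then show ?thesis using outside[OF False] by (auto simp: flat_def U_def)
  qed
  then have "flat g U = \<eta>" by (intro ext)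
  moreover have "U \<in> vector_fields A"
    unfolding vector_fields_def
  proof (intro CollectI conjI allI ballI impI)
    show "U c p = 0" if "\<not> (c \<in> A \<and> p \<in> fst c)" for c p using that by (auto simp: U_def)
    show "smooth_on (\<lambda>x. U c (chart_inv c x)) (snd c ` fst c)" if c: "c \<in> A" for c
      unfolding smooth_on_def
    proof
      fix m
      have comp: "Ck_on m (\<lambda>x. g c (chart_inv c x) $ i $ j) (snd c ` fst c)" for i j
        using metric_smooth[OF g c] unfolding smooth_on_def by (intro Ck_on_vec_nth) simp
      have "Ck_on m (\<lambda>x. G c (chart_inv c x) k $ i $ j) (snd c ` fst c)" for i j k
        using comp[of i j] smooth[OF c] by (cases "j = k") (simp_all add: G_def a_def)
      then have "Ck_on m (\<lambda>x. det (G c (chart_inv c x) k)) (snd c ` fst c)" for k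
        by (rule Ck_on_det)
      moreover have "Ck_on m (\<lambda>x. det (g c (chart_inv c x)) powr (-1)) (snd c ` fst c)"
        using Ck_on_metric_det[OF g c] det_metric_pos[OF g c chart_inv_mem] by (rule Ck_on_powr)
      ultimately have "Ck_on m (\<lambda>x. det (G c (chart_inv c x) k) * det (g c (chart_inv c x)) powr (-1)) (snd c ` fst c)" for k
        by (rule Ck_on_mult)
      then have "Ck_on m (\<lambda>x. \<chi> k. det (G c (chart_inv c x) k) * det (g c (chart_inv c x)) powr (-1)) (snd c ` fst c)"
        by (intro Ck_on_vec) simp
      then show "Ck_on m (\<lambda>x. U c (chart_inv c x)) (snd c ` fst c)"
        by (rule Ck_on_cong[OF open_chart_image[OF M c], rotated]) (simp add: U_def c chart_inv_mem)
    qed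
    show "U c' p = transition_jacobian c c' p *v U c p"
      if c: "c \<in> A" "c' \<in> A" and p: "p \<in> fst c \<inter> fst c'" for c c' p
    proof -
      let ?J = "transition_jacobian c c' p"
      \<comment> \<open>The defect of the transformation law. Evaluating the form on a preimage
        \<open>x\<close> of \<open>y\<close> in both charts shows that \<open>y\<close> has length
        zero in the metric, so definiteness gives \<open>y = 0\<close>.\<close>
      define y where "y = ?J *v U c p - U c' p"
      obtain x where x: "?J *v x = y" using matrix_vector_surj[OF det_transition_neq_0[OF g c p]] .
      have "x \<bullet> (g c p *v U c p) = y \<bullet> (g c' p *v U c' p)"
        using trans[OF c p, of "\<lambda>_. x"] c p by (simp add: \<eta>_eq gU x)
      moreover have "x \<bullet> (g c p *v U c p) = y \<bullet> (g c' p *v (?J *v U c p))"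
        unfolding metric_transition[OF g c p] x[symmetric]
        by (simp only: matrix_vector_mul_assoc[symmetric] inner_transpose_matrix)
      ultimately have "y \<bullet> (g c' p *v y) = 0"
        by (simp add: y_def matrix_vector_mult_diff_distrib inner_diff_right)
      then have "y = 0" using metric_pos[OF g c(2), of p y] p by force
      then show ?thesis by (simp add: y_def)
    qed
  qed
  ultimately show thesis using that by blast
qed

lemma interior_product_volume_form:
  "interior_product Z (volume_form g) c p v = sqrt (det (g c p)) * det_form (case_nat (Z c p) v)"
  by (simp add: interior_product_def volume_form_def det_form_def)

lemma interior_product_volume_form_surj:
  fixes A :: "('a, 'n::{finite,linorder}) chart set"
  assumes M: "smooth_manifold M A" and g: "riemannian_metric A g"
    and \<zeta>: "\<zeta> \<in> twisted_forms A (CARD('n) - 1)"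
  obtains Z where "Z \<in> vector_fields A" "interior_product Z (volume_form g) = \<zeta>"
proof -
  define b :: "_ \<Rightarrow> _ \<Rightarrow> (real, 'n) vec" where
    "b c p = (\<chi> a. coframe_sign (coord_index a) * \<zeta> c p (coframe (coord_index a)))" for c p
  \<comment> \<open>The exponent \<open>-1/2\<close> cancels the density sqrt(det g) of the volume
    form.\<close>
  define Z where "Z c p = (if c \<in> A \<and> p \<in> fst c then det (g c p) powr (-1/2) *\<^sub>R b c p else 0)" for c p
  have alt: "alternating_form (CARD('n) - 1) (\<zeta> c p)" if "c \<in> A" "p \<in> fst c" for c p
    using \<zeta> that unfolding twisted_forms_def smooth_form_components_def by blast
  have smooth: "Ck_on k (\<lambda>x. \<zeta> c (chart_inv c x) v) (snd c ` fst c)" if "c \<in> A" for c k v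
    using \<zeta> that unfolding twisted_forms_def smooth_form_components_def smooth_on_def by blast
  have outside: "\<zeta> c p = (\<lambda>v. 0)" if "\<not> (c \<in> A \<and> p \<in> fst c)" for c p
    using \<zeta> that unfolding twisted_forms_def smooth_form_components_def by blast
  have trans: "\<zeta> c p v = sgn (det (transition_jacobian c c' p)) *
        \<zeta> c' p (\<lambda>i. transition_jacobian c c' p *v v i)"
    if "c \<in> A" "c' \<in> A" "p \<in> fst c \<inter> fst c'" for c c' p v
    using \<zeta> that unfolding twisted_forms_def by blast
  have \<zeta>_eq: "sqrt (det (g c p)) * det_form (case_nat (Z c p) v) = \<zeta> c p v"
    if "c \<in> A" "p \<in> fst c" for c p v
  proof -
    have d: "0 < det (g c p)" by (rule det_metric_pos[OF g that])
    have "sqrt (det (g c p)) * det (g c p) powr (-1/2) = 1"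
      using d by (simp add: powr_minus powr_half_sqrt)
    moreover have "det_form (case_nat (Z c p) v) = det (g c p) powr (-1/2) * det_form (case_nat (b c p) v)"
      using that linear_cmul[OF linear_det_form_case_nat[of v], of "det (g c p) powr (-1/2)" "b c p"]
      by (simp add: Z_def)
    moreover have "det_form (case_nat (b c p) v) = \<zeta> c p v"
      unfolding b_def by (rule alternating_form_codegree_1[OF alt[OF that], symmetric])
    ultimately show ?thesis by (metis mult.assoc mult_1)
  qed
  have "interior_product Z (volume_form g) c p v = \<zeta> c p v" for c p v
  proof (cases "c \<in> A \<and> p \<in> fst c")
    case True
    then show ?thesis using \<zeta>_eq by (simp add: interior_product_volume_form)
  next
    case False
    \<comment> \<open>Off the chart the metric is the zero matrix, so the volume form vanishes there
      in agreement with the default value of \<open>\<zeta>\<close>.\<close>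
    have "det (0 :: ((real, 'n) vec, 'n) vec) = 0"
      by (rule det_zero_row(1)[where i=undefined]) (simp add: row_def vec_eq_iff)
    then show ?thesis
      using outside[OF False] metric_outside[OF g False] by (simp add: interior_product_volume_form)
  qed
  then have "interior_product Z (volume_form g) = \<zeta>" by (intro ext)
  moreover have "Z \<in> vector_fields A"
    unfolding vector_fields_def
  proof (intro CollectI conjI allI ballI impI)
    show "Z c p = 0" if "\<not> (c \<in> A \<and> p \<in> fst c)" for c p using that by (auto simp: Z_def)
    show "smooth_on (\<lambda>x. Z c (chart_inv c x)) (snd c ` fst c)" if c: "c \<in> A" for c
      unfolding smooth_on_def
    proof
      fix m
      have "Ck_on m (\<lambda>x. det (g c (chart_inv c x)) powr (-1/2)) (snd c ` fst c)"
        using Ck_on_metric_det[OF g c] det_metric_pos[OF g c chart_inv_mem] by (rule Ck_on_powr)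
      moreover have "Ck_on m (\<lambda>x. b c (chart_inv c x) $ a) (snd c ` fst c)" for a
        using Ck_on_mult[OF Ck_on_const smooth[OF c]] by (simp add: b_def)
      ultimately have "Ck_on m (\<lambda>x. det (g c (chart_inv c x)) powr (-1/2) * b c (chart_inv c x) $ a)
          (snd c ` fst c)" for a
        by (rule Ck_on_mult)
      then have "Ck_on m (\<lambda>x. det (g c (chart_inv c x)) powr (-1/2) *\<^sub>R b c (chart_inv c x)) (snd c ` fst c)"
        by (intro Ck_on_vec) simp
      then show "Ck_on m (\<lambda>x. Z c (chart_inv c x)) (snd c ` fst c)"
        by (rule Ck_on_cong[OF open_chart_image[OF M c], rotated]) (simp add: Z_def c chart_inv_mem)
    qed
    show "Z c' p = transition_jacobian c c' p *v Z c p"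
      if c: "c \<in> A" "c' \<in> A" and p: "p \<in> fst c \<inter> fst c'" for c c' p
    proof (rule det_form_case_nat_inject)
      fix w :: "nat \<Rightarrow> (real, 'n) vec"
      let ?J = "transition_jacobian c c' p"
      have J: "det ?J \<noteq> 0" by (rule det_transition_neq_0[OF g c p])
      \<comment> \<open>Every test tuple \<open>w\<close> is the image of a tuple \<open>v\<close>,
        at which the law of \<open>\<zeta>\<close> relates the two charts.\<close>
      have "\<forall>i. \<exists>x. ?J *v x = w i" using cramer[OF J] by simp
      then have "\<exists>v. \<forall>i. ?J *v v i = w i" by (rule choice)
      then obtain v where v: "\<And>i. ?J *v v i = w i" by auto
      have s: "0 < sqrt (det (g c' p))" using det_metric_pos[OF g, of c' p] c p by simp
      have "(\<lambda>i. ?J *v case_nat (Z c p) v i) = case_nat (?J *v Z c p) w"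
        using v by (auto simp: fun_eq_iff split: nat.split)
      then have "det_form (case_nat (?J *v Z c p) w) = det ?J * det_form (case_nat (Z c p) v)"
        using det_form_matrix_vector_mult[of ?J "case_nat (Z c p) v"] by simp
      \<comment> \<open>The density contributes |det J|, the twisted law sgn(det J), and the
        determinant det J. These match exactly because \<open>\<zeta>\<close> is twisted; a straight
        form would leave a sign in the law of \<open>Z\<close>.\<close>
      moreover have "sqrt (det (g c p)) = \<bar>det ?J\<bar> * sqrt (det (g c' p))"
        by (simp add: det_metric_transition[OF g c p] real_sqrt_mult)
      moreover have "sqrt (det (g c p)) * det_form (case_nat (Z c p) v) =
          sgn (det ?J) * (sqrt (det (g c' p)) * det_form (case_nat (Z c' p) w))"
        using trans[OF c p, of v] \<zeta>_eq c p v by simp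
      ultimately show "det_form (case_nat (Z c' p) w) = det_form (case_nat (?J *v Z c p) w)"
        using s J by (auto simp: sgn_if abs_if split: if_splits)
    qed
  qed
  ultimately show thesis using that by blast
qed

section \<open>Linearity of the two isomorphisms\<close>

lemma flat_add: "flat g (U + V) = flat g U + flat g V"
  by (simp add: flat_def fun_eq_iff matrix_vector_right_distrib inner_add_right)

lemma flat_scaleR: "flat g (r *\<^sub>R U) = r *\<^sub>R flat g U"
  by (simp add: flat_def fun_eq_iff scaleR_fun_def matrix_vector_mult_scaleR)

lemma interior_product_volume_form_add:
  "interior_product (U + V) (volume_form g) =
    interior_product U (volume_form g) + interior_product V (volume_form g)"
  by (simp add: fun_eq_iff interior_product_volume_form linear_add[OF linear_det_form_case_nat]
      distrib_left)

lemma interior_product_volume_form_scaleR: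
  "interior_product (r *\<^sub>R U) (volume_form g) = r *\<^sub>R interior_product U (volume_form g)"
  by (simp add: fun_eq_iff scaleR_fun_def interior_product_volume_form
      linear_cmul[OF linear_det_form_case_nat])


section \<open>Integration of twisted top-degree forms\<close>

text \<open>The Lindelof property gives a countable subcover, and each point is assigned to the
  chart of least rank containing it. Pieces are differences of open sets in coordinates, hence
  Borel.\<close>

lemma exists_chart_partition:
  fixes A :: "('a, 'n::finite) chart set"
  assumes M: "smooth_manifold M A" and c0: "c0 \<in> A"
  obtains B where "chart_partition M A B" "B c0 = fst c0"
proof -
  have "Lindelof_space M"
    using M by (intro second_countable_imp_Lindelof_space) (simp add: smooth_manifold_def)
  moreover have "\<Union>(fst ` A) = topspace M" using Union_charts[OF M] by simp
  moreover have "openin M U" if "U \<in> fst ` A" for U using openin_chart[OF M] that by blast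
  ultimately obtain \<V> where \<V>: "countable \<V>" "\<V> \<subseteq> fst ` A" "\<Union>\<V> = topspace M"
    using Lindelof_spaceD[of M "fst ` A"] by metis
  then obtain C where C: "C \<subseteq> A" "countable C" "fst ` C = \<V>"
    using countable_subset_image[of \<V> fst A] by auto
  \<comment> \<open>Rank 0 is reserved for \<open>c0\<close>, so nothing is removed from its domain;
    \<open>Suc\<close> keeps all other ranks above it.\<close>
  define i where "i c = (if c = c0 then 0 else Suc (to_nat_on C c))" for c
  have inj_i: "c = c'" if "c \<in> insert c0 C" "c' \<in> insert c0 C" "i c = i c'" for c c'
  proof (cases "c = c0 \<or> c' = c0")
    case True
    then show ?thesis using that(3) unfolding i_def by (metis nat.distinct(1))
  next
    case False
    then have "c \<in> C" "c' \<in> C" "to_nat_on C c = to_nat_on C c'" using that by (simp_all add: i_def)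
    then show ?thesis using to_nat_on_inj[OF C(2)] by blast
  qed
  define E where "E c = \<Union>(fst ` {c' \<in> insert c0 C. i c' < i c})" for c
  define B where "B c = (if c \<in> insert c0 C then fst c - E c else {})" for c
  have E: "openin M (E c)" for c
    unfolding E_def using openin_chart[OF M] C(1) c0 by (intro openin_Union) blast
  have "B c0 = fst c0" by (auto simp: B_def E_def i_def)
  moreover have "chart_partition M A B"
    unfolding chart_partition_def
  proof (intro conjI ballI)
    show "B c \<subseteq> fst c" for c by (auto simp: B_def)
    show "snd c ` B c \<in> sets borel" if c: "c \<in> A" for c
    proof (cases "c \<in> insert c0 C")
      case True
      have "snd c ` B c = snd c ` fst c - snd c ` (fst c \<inter> E c)"
        using True inj_on_image_set_diff[OF inj_on_chart[OF M c], of "fst c" "fst c \<inter> E c"]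
        by (simp add: B_def Diff_Int)
      also have "\<dots> \<in> sets borel"
        using open_chart_image[OF M c] open_chart_image_Int[OF M c E] by (intro sets.Diff) auto
      finally show ?thesis .
    qed (simp add: B_def)
    have "{c \<in> A. B c \<noteq> {}} \<subseteq> insert c0 C" by (auto simp: B_def)
    then show "countable {c \<in> A. B c \<noteq> {}}" by (rule countable_subset) (simp add: C(2))
    show "disjoint_family_on B A"
      unfolding disjoint_family_on_def
    proof (intro ballI impI)
      fix c c' assume "c \<in> A" "c' \<in> A" "c \<noteq> c'"
      show "B c \<inter> B c' = {}"
      proof (rule ccontr)
        assume "B c \<inter> B c' \<noteq> {}"
        then obtain p where p: "p \<in> B c" "p \<in> B c'" by blast
        then have m: "c \<in> insert c0 C" "c' \<in> insert c0 C" by (auto simp: B_def split: if_splits)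
        have "p \<in> fst c" "p \<notin> E c" "p \<in> fst c'" "p \<notin> E c'" using p m by (simp_all add: B_def)
        then have "\<not> i c < i c'" "\<not> i c' < i c" using m unfolding E_def by blast+
        then show False using inj_i[OF m] \<open>c \<noteq> c'\<close> by simp
      qed
    qed
    show "(\<Union>c\<in>A. B c) = topspace M"
    proof
      show "(\<Union>c\<in>A. B c) \<subseteq> topspace M" using Union_charts[OF M] by (auto simp: B_def)
      show "topspace M \<subseteq> (\<Union>c\<in>A. B c)"
      proof
        fix p assume "p \<in> topspace M"
        then obtain c1 where c1: "c1 \<in> insert c0 C \<and> p \<in> fst c1" using \<V>(3) C(3) by blast
        obtain c where c: "c \<in> insert c0 C \<and> p \<in> fst c"
          and least: "\<forall>c'. c' \<in> insert c0 C \<and> p \<in> fst c' \<longrightarrow> i c \<le> i c'"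
          using ex_has_least_nat[of "\<lambda>c. c \<in> insert c0 C \<and> p \<in> fst c", OF c1, of i] by blast
        from least have "p \<notin> E c" unfolding E_def using leD by blast
        with c have "p \<in> B c" by (simp add: B_def)
        then show "p \<in> (\<Union>c\<in>A. B c)" using c C(1) c0 by blast
      qed
    qed
  qed
  ultimately show thesis using that by blast
qed

text \<open>The value is required for every partition, so it is unique as soon as one partition
  exists: sums in the sense of \<open>has_sum\<close> are unique.\<close>

lemma twisted_integral_eq:
  fixes A :: "('a, 'n::{finite,linorder}) chart set"
  assumes M: "smooth_manifold M A" and I: "twisted_has_integral M A \<mu> I"
  shows "twisted_integral M A \<mu> = I"
proof -
  obtain B where B: "chart_partition M A B"
  \<comment> \<open>\<open>exists_chart_partition\<close> starts from a chart. An empty atlas forces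
    an empty manifold, partitioned by empty pieces.\<close>
  proof (cases "A = {}")
    case True
    then have "chart_partition M A (\<lambda>_. {})"
      using Union_charts[OF M] by (simp add: chart_partition_def disjoint_family_on_def)
    then show thesis using that by blast
  next
    case False
    then show thesis using that exists_chart_partition[OF M] by blast
  qed
  have "J = I" if "twisted_has_integral M A \<mu> J" for J
    using that I B unfolding twisted_has_integral_def by (blast intro: has_sum_unique)
  then show ?thesis unfolding twisted_integral_def using I by (intro the_equality)
qed

lemma twisted_has_integral_integral:
  assumes "smooth_manifold M A" "twisted_integrable M A \<mu>"
  shows "twisted_has_integral M A \<mu> (twisted_integral M A \<mu>)"
  using assms twisted_integral_eq unfolding twisted_integrable_def by metis

lemma twisted_has_integral_cong_imp:
  assumes eq: "\<And>c p. c \<in> A \<Longrightarrow> p \<in> fst c \<Longrightarrow> \<mu> c p coord_frame = \<nu> c p coord_frame"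
    and I: "twisted_has_integral M A \<mu> I"
  shows "twisted_has_integral M A \<nu> I"
  unfolding twisted_has_integral_def
proof (intro allI impI)
  fix B assume B: "chart_partition M A B"
  have sub: "snd c ` B c \<subseteq> snd c ` fst c" and meas: "snd c ` B c \<in> sets lborel" if "c \<in> A" for c
    using B that unfolding chart_partition_def by auto
  have d: "coord_density \<mu> c x = coord_density \<nu> c x" if "c \<in> A" "x \<in> snd c ` B c" for c x
    unfolding coord_density_def using eq[OF that(1) chart_inv_mem] sub[OF that(1)] that(2) by blast
  have int: "(LINT x:snd c ` B c|lborel. coord_density \<mu> c x) = (LINT x:snd c ` B c|lborel. coord_density \<nu> c x)"
    and int_abs: "(LINT x:snd c ` B c|lborel. \<bar>coord_density \<mu> c x\<bar>) = (LINT x:snd c ` B c|lborel. \<bar>coord_density \<nu> c x\<bar>)"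
    if "c \<in> A" for c
    using d[OF that] meas[OF that] by (auto intro!: set_lebesgue_integral_cong)
  have set_int: "set_integrable lborel (snd c ` B c) (coord_density \<mu> c) = set_integrable lborel (snd c ` B c) (coord_density \<nu> c)"
    if "c \<in> A" for c
    using d[OF that] by (intro set_integrable_cong refl)
  have "\<forall>c\<in>A. set_integrable lborel (snd c ` B c) (coord_density \<mu> c)"
    and "(\<lambda>c. LINT x:snd c ` B c|lborel. \<bar>coord_density \<mu> c x\<bar>) summable_on A"
    and "((\<lambda>c. LINT x:snd c ` B c|lborel. coord_density \<mu> c x) has_sum I) A"
    using I B unfolding twisted_has_integral_def by simp_all
  moreover have "(\<lambda>c. LINT x:snd c ` B c|lborel. \<bar>coord_density \<mu> c x\<bar>) summable_on A \<longleftrightarrow>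
      (\<lambda>c. LINT x:snd c ` B c|lborel. \<bar>coord_density \<nu> c x\<bar>) summable_on A"
    by (rule summable_on_cong) (rule int_abs)
  moreover have "((\<lambda>c. LINT x:snd c ` B c|lborel. coord_density \<mu> c x) has_sum I) A \<longleftrightarrow>
      ((\<lambda>c. LINT x:snd c ` B c|lborel. coord_density \<nu> c x) has_sum I) A"
    by (rule has_sum_cong) (rule int)
  ultimately show "(\<forall>c\<in>A. set_integrable lborel (snd c ` B c) (coord_density \<nu> c)) \<and>
     (\<lambda>c. LINT x:snd c ` B c|lborel. \<bar>coord_density \<nu> c x\<bar>) summable_on A \<and>
     ((\<lambda>c. LINT x:snd c ` B c|lborel. coord_density \<nu> c x) has_sum I) A"
    by (simp add: set_int)
qed

lemma twisted_has_integral_cong: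
  assumes "\<And>c p. c \<in> A \<Longrightarrow> p \<in> fst c \<Longrightarrow> \<mu> c p coord_frame = \<nu> c p coord_frame"
  shows "twisted_has_integral M A \<mu> = twisted_has_integral M A \<nu>"
  using twisted_has_integral_cong_imp[of A \<mu> \<nu>] twisted_has_integral_cong_imp[of A \<nu> \<mu>] assms
  by (auto simp: fun_eq_iff)

section \<open>The Poincare pairing as an integral of the metric product\<close>

lemma wedge_flat_interior_product:
  fixes g :: "('a, 'n::{finite,linorder}) mfield"
  shows "wedge 1 (CARD('n) - 1) (flat g U) (interior_product Z (volume_form g)) c p coord_frame =
    scale_form (metric_dot g Z U) (volume_form g) c p coord_frame"
proof -
  have "wedge 1 (CARD('n) - 1) (flat g U) (interior_product Z (volume_form g)) c p coord_frame =
    sqrt (det (g c p)) *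
    ((\<Sum>\<sigma> | \<sigma> permutes {..<CARD('n)}. of_int (sign \<sigma>) * (coord_frame (\<sigma> 0) \<bullet> (g c p *v U c p)) *
            det_form (case_nat (Z c p) (\<lambda>i. coord_frame (\<sigma> (Suc i))))) / fact (CARD('n) - 1))"
    by (simp add: wedge_def interior_product_volume_form flat_def sum_distrib_left mult_ac)
  also have "\<dots> = sqrt (det (g c p)) * (\<Sum>j\<in>UNIV. (coord_frame (coord_index j) \<bullet> (g c p *v U c p)) * Z c p $ j)"
    by (simp only: wedge_1_det_form[of "\<lambda>x. x \<bullet> (g c p *v U c p)"])
  also have "\<dots> = sqrt (det (g c p)) * (Z c p \<bullet> (g c p *v U c p))"
    unfolding inner_coord_frame by (simp add: inner_vec_def mult.commute)
  also have "\<dots> = scale_form (metric_dot g Z U) (volume_form g) c p coord_frame"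
    using det_form_coord_frame[where 'a='n]
    by (simp add: scale_form_def volume_form_def det_form_def metric_dot_def mult.commute)
  finally show ?thesis .
qed

lemma pairing_flat_interior_product:
  fixes A :: "('a, 'n::{finite,linorder}) chart set"
  shows "pairing_converges M A 1 (flat g U) (interior_product Z (volume_form g)) \<longleftrightarrow>
      twisted_integrable M A (scale_form (metric_dot g Z U) (volume_form g))"
    and "poincare_pairing M A 1 (flat g U) (interior_product Z (volume_form g)) =
      twisted_integral M A (scale_form (metric_dot g Z U) (volume_form g))"
proof -
  have "twisted_has_integral M A (wedge 1 (CARD('n) - 1) (flat g U) (interior_product Z (volume_form g))) =
    twisted_has_integral M A (scale_form (metric_dot g Z U) (volume_form g))"
    by (rule twisted_has_integral_cong) (rule wedge_flat_interior_product)
  then show "pairing_converges M A 1 (flat g U) (interior_product Z (volume_form g)) \<longleftrightarrow>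
      twisted_integrable M A (scale_form (metric_dot g Z U) (volume_form g))"
    and "poincare_pairing M A 1 (flat g U) (interior_product Z (volume_form g)) =
      twisted_integral M A (scale_form (metric_dot g Z U) (volume_form g))"
    by (simp_all only: pairing_converges_def poincare_pairing_def twisted_integrable_def twisted_integral_def)
qed

text \<open>The set where \<open>y\<close> is nonzero is open and null, hence empty.\<close>

lemma continuous_AE_zero_on_open:
  fixes y :: "'b::euclidean_space \<Rightarrow> 'c::real_normed_vector"
  assumes "open S" "continuous_on S y" "AE x in lborel. x \<in> S \<longrightarrow> y x = 0" "x \<in> S"
  shows "y x = 0"
proof (rule ccontr)
  assume "y x \<noteq> 0"
  have "open {x \<in> S. y x \<noteq> 0}"
    using continuous_open_preimage[OF assms(2,1), of "- {0}"] by (simp add: vimage_def Int_def open_Compl)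
  moreover from this have "{x \<in> S. y x \<noteq> 0} \<in> null_sets lborel"
    using assms(3) by (subst AE_iff_null_sets) (auto intro: borel_open)
  then have "negligible {x \<in> S. y x \<noteq> 0}"
    by (simp add: negligible_iff_null_sets null_sets_completionI)
  ultimately show False using open_not_negligible \<open>y x \<noteq> 0\<close> \<open>x \<in> S\<close> by blast
qed

lemma vector_field_eqI:
  fixes A :: "('a, 'n::{finite,linorder}) chart set"
  assumes M: "smooth_manifold M A" and g: "riemannian_metric A g"
    and Y: "Z - W \<in> vector_fields A"
    and int: "twisted_integrable M A (scale_form (metric_dot g Z (Z - W)) (volume_form g))"
      "twisted_integrable M A (scale_form (metric_dot g W (Z - W)) (volume_form g))"
    and eq: "twisted_integral M A (scale_form (metric_dot g Z (Z - W)) (volume_form g)) =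
      twisted_integral M A (scale_form (metric_dot g W (Z - W)) (volume_form g))"
  shows "Z = W"
proof -
  define Y where "Y = Z - W"
  define f where "f T = coord_density (scale_form (metric_dot g T Y) (volume_form g))" for T
  define q where "q c x = metric_dot g Y Y c (chart_inv c x) * sqrt (det (g c (chart_inv c x)))" for c x
  have f_diff: "f Z c x - f W c x = q c x" for c x
    using det_form_coord_frame[where 'a='n]
    by (simp add: f_def q_def coord_density_def scale_form_def volume_form_def det_form_def
        metric_dot_def Y_def inner_diff_left left_diff_distrib)
  have q_nonneg: "0 \<le> q c x" and q_0: "q c x = 0 \<Longrightarrow> Y c (chart_inv c x) = 0"
    if "c \<in> A" "x \<in> snd c ` fst c" for c x
  proof -
    have p: "chart_inv c x \<in> fst c" by (rule chart_inv_mem[OF that(2)])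
    have "0 < sqrt (det (g c (chart_inv c x)))" using det_metric_pos[OF g that(1) p] by simp
    moreover have "Y c (chart_inv c x) = 0 \<or> 0 < metric_dot g Y Y c (chart_inv c x)"
      using metric_dot_pos[OF g that(1) p, of Y] by blast
    ultimately show "0 \<le> q c x" "q c x = 0 \<Longrightarrow> Y c (chart_inv c x) = 0"
      by (auto simp: q_def metric_dot_def)
  qed
  have "Y c p = 0" if c: "c \<in> A" and p: "p \<in> fst c" for c p
  proof -
    \<comment> \<open>With the whole domain of \<open>c\<close> as one piece, vanishing almost
      everywhere on the piece is a statement on an open coordinate set, where continuity upgrades
      it.\<close>
    obtain B where B: "chart_partition M A B" and Bc: "B c = fst c"
      using exists_chart_partition[OF M c] .
    have si: "set_integrable lborel (snd c ` B c) (f T c)"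
      and hs: "((\<lambda>c. LINT x:snd c ` B c|lborel. f T c x) has_sum
        twisted_integral M A (scale_form (metric_dot g Z Y) (volume_form g))) A"
      if "c \<in> A" "T = Z \<or> T = W" for c T
      using twisted_has_integral_integral[OF M int(1)] twisted_has_integral_integral[OF M int(2)]
        B that eq unfolding twisted_has_integral_def f_def Y_def by auto
    have sub: "snd c ` B c \<subseteq> snd c ` fst c" if "c \<in> A" for c
      using B that unfolding chart_partition_def by auto
    have qi: "set_integrable lborel (snd c ` B c) (q c)"
      and qint: "(LINT x:snd c ` B c|lborel. q c x) =
        (LINT x:snd c ` B c|lborel. f Z c x) - (LINT x:snd c ` B c|lborel. f W c x)"
      if "c \<in> A" for c
      using set_integral_diff[OF si[of c Z] si[of c W]] that by (simp_all add: f_diff)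
    have q_ind: "0 \<le> indicator (snd c ` B c) x *\<^sub>R q c x" if "c \<in> A" for c x
      using q_nonneg[OF that, of x] sub[OF that] by (auto simp: indicator_def)
    have qint_nonneg: "0 \<le> (LINT x:snd c ` B c|lborel. q c x)" if "c \<in> A" for c
      unfolding set_lebesgue_integral_def using q_ind[OF that] by (intro integral_nonneg_AE) simp
    have "(LINT x:snd c ` B c|lborel. q c x) = 0"
    proof (rule ccontr)
      assume "(LINT x:snd c ` B c|lborel. q c x) \<noteq> 0"
      then have "(LINT x:snd c ` B c|lborel. f W c x) < (LINT x:snd c ` B c|lborel. f Z c x)"
        using qint[OF c] qint_nonneg[OF c] by simp
      \<comment> \<open>By \<open>eq\<close> both families have the same sum, yet each term for
        \<open>W\<close> is at most the term for \<open>Z\<close>, strictly so at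
        \<open>c\<close>.\<close>
      then show False
        using has_sum_strict_mono[OF hs[OF c, of W] hs[OF c, of Z] _ c] qint qint_nonneg by fastforce
    qed
    then have "AE x in lborel. indicator (snd c ` B c) x *\<^sub>R q c x = 0"
      using qi[OF c] q_ind[OF c] integral_nonneg_eq_0_iff_AE[of lborel "\<lambda>x. indicator (snd c ` B c) x *\<^sub>R q c x"]
      unfolding set_lebesgue_integral_def set_integrable_def by simp
    then have "AE x in lborel. x \<in> snd c ` fst c \<longrightarrow> Y c (chart_inv c x) = 0"
      by (rule AE_mp) (use q_0[OF c] Bc in auto)
    moreover have "continuous_on (snd c ` fst c) (\<lambda>x. Y c (chart_inv c x))"
      using Y c by (intro smooth_on_imp_continuous_on) (auto simp: Y_def vector_fields_def)
    ultimately have "Y c (chart_inv c (snd c p)) = 0"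
      using p by (intro continuous_AE_zero_on_open[OF open_chart_image[OF M c]]) auto
    then show ?thesis by (simp add: chart_inv_chart[OF M c p])
  qed
  moreover have "Y c p = 0" if "\<not> (c \<in> A \<and> p \<in> fst c)" for c p
    using Y that unfolding Y_def vector_fields_def by blast
  ultimately have "Y c p = 0" for c p by blast
  then show ?thesis by (simp add: Y_def fun_eq_iff)
qed


section \<open>Frechet derivatives on normed subspaces\<close>

lemma frechet_on_approx:
  assumes "frechet_on S N F x D" "0 < \<epsilon>"
  obtains \<delta> where "0 < \<delta>" "\<And>h. h \<in> S \<Longrightarrow> N h < \<delta> \<Longrightarrow> \<bar>F (x + h) - F x - D h\<bar> \<le> \<epsilon> * N h"
proof -
  have "\<forall>\<epsilon>>0. \<exists>\<delta>>0. \<forall>h\<in>S. N h < \<delta> \<longrightarrow> \<bar>F (x + h) - F x - D h\<bar> \<le> \<epsilon> * N h"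
    using assms(1) unfolding frechet_on_def by (elim conjE)
  from this[rule_format, OF assms(2)] show thesis using that by blast
qed

text \<open>Along the ray through \<open>u\<close> the two linear maps differ by a multiple of
  \<open>t\<close>, while both approximate the same increment up to o(t).\<close>

lemma frechet_on_unique:
  assumes S: "normed_subspace S N" and D: "frechet_on S N F x D" and D': "frechet_on S N F x D'"
    and u: "u \<in> S"
  shows "D u = D' u"
proof (rule ccontr)
  assume neq: "D u \<noteq> D' u"
  have lin: "D (t *\<^sub>R u) = t * D u" "D' (t *\<^sub>R u) = t * D' u" for t
    using D D' u unfolding frechet_on_def by blast+
  have "u \<noteq> 0" using lin[of 0] neq lin[of 1] by auto
  then have N: "0 < N u" "N (t *\<^sub>R u) = \<bar>t\<bar> * N u" for t
    using S u unfolding normed_subspace_def by (auto simp: order_less_le)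
  \<comment> \<open>A quarter of the gap per unit of norm: the two errors together then amount to at
    most half the gap.\<close>
  define \<epsilon> where "\<epsilon> = \<bar>D u - D' u\<bar> / (4 * N u)"
  have "0 < \<epsilon>" using neq N(1) by (simp add: \<epsilon>_def)
  obtain \<delta> where \<delta>: "0 < \<delta>" "\<And>h. h \<in> S \<Longrightarrow> N h < \<delta> \<Longrightarrow> \<bar>F (x + h) - F x - D h\<bar> \<le> \<epsilon> * N h"
    using frechet_on_approx[OF D \<open>0 < \<epsilon>\<close>] by blast
  obtain \<delta>' where \<delta>': "0 < \<delta>'" "\<And>h. h \<in> S \<Longrightarrow> N h < \<delta>' \<Longrightarrow> \<bar>F (x + h) - F x - D' h\<bar> \<le> \<epsilon> * N h"
    using frechet_on_approx[OF D' \<open>0 < \<epsilon>\<close>] by blast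
  \<comment> \<open>Scales \<open>u\<close> to norm \<open>min \<delta> \<delta>' / 2\<close>,
    strictly below both radii.\<close>
  define t where "t = min \<delta> \<delta>' / (2 * N u)"
  have t: "0 < t" using \<delta>(1) \<delta>'(1) N(1) by (simp add: t_def)
  have "subspace S" using S unfolding normed_subspace_def by (elim conjE)
  then have tS: "t *\<^sub>R u \<in> S" using u by (rule subspace_scale)
  have "N (t *\<^sub>R u) = t * N u" using N(2) t by simp
  also have "\<dots> = min \<delta> \<delta>' / 2" using N(1) by (simp add: t_def)
  finally have "N (t *\<^sub>R u) < \<delta>" "N (t *\<^sub>R u) < \<delta>'" using \<delta>(1) \<delta>'(1) by linarith+
  then have "\<bar>F (x + t *\<^sub>R u) - F x - D (t *\<^sub>R u)\<bar> \<le> \<epsilon> * N (t *\<^sub>R u)"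
    "\<bar>F (x + t *\<^sub>R u) - F x - D' (t *\<^sub>R u)\<bar> \<le> \<epsilon> * N (t *\<^sub>R u)"
    by (simp_all only: \<delta>(2)[OF tS] \<delta>'(2)[OF tS])
  then have "\<bar>F (x + t *\<^sub>R u) - F x - t * D u\<bar> \<le> \<epsilon> * (t * N u)"
    "\<bar>F (x + t *\<^sub>R u) - F x - t * D' u\<bar> \<le> \<epsilon> * (t * N u)"
    using t unfolding lin N(2) by simp_all
  then have "\<bar>t * D u - t * D' u\<bar> \<le> 2 * (\<epsilon> * (t * N u))" by linarith
  moreover have "\<bar>t * D u - t * D' u\<bar> = t * \<bar>D u - D' u\<bar>"
    using t by (simp add: abs_mult flip: right_diff_distrib)
  moreover have "2 * (\<epsilon> * (t * N u)) = t * \<bar>D u - D' u\<bar> / 2"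
    using N(1) by (simp add: \<epsilon>_def)
  moreover have "0 < t * \<bar>D u - D' u\<bar>" using t neq by simp
  ultimately show False by linarith
qed

text \<open>The estimate of \<open>N u\<close> by a multiple of \<open>N' (T u)\<close> carries
  boundedness and the remainder estimate from \<open>X\<close> to \<open>L\<close>; linearity of
  \<open>T\<close> on \<open>X\<close> carries the algebra.\<close>

lemma frechet_on_transport:
  assumes X: "normed_subspace X N" and N': "normed_subspace L N'" and L: "T ` X = L"
    and add: "\<And>u v. u \<in> X \<Longrightarrow> v \<in> X \<Longrightarrow> T (u + v) = T u + T v"
    and scale: "\<And>u r. u \<in> X \<Longrightarrow> T (r *\<^sub>R u) = r *\<^sub>R T u"
    and bi: "bicontinuous_on X N N' T"
    and F: "\<And>u. u \<in> X \<Longrightarrow> F (T u) = K u"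
    and D': "\<And>u. u \<in> X \<Longrightarrow> D' (T u) = D u"
    and D: "frechet_on X N K V D"
  shows "frechet_on L N' F (T V) D'"
proof -
  have sub: "subspace X" and N: "\<And>u. u \<in> X \<Longrightarrow> 0 \<le> N u"
    using X unfolding normed_subspace_def by blast+
  have N'0: "0 \<le> N' (T u)" if "u \<in> X" for u
    using N' that unfolding normed_subspace_def L[symmetric] by blast
  obtain C0 where C0: "\<And>u. u \<in> X \<Longrightarrow> N' (T u) \<le> C0 * N u \<and> N u \<le> C0 * N' (T u)"
    using bi unfolding bicontinuous_on_def by blast
  \<comment> \<open>The constant supplied by bicontinuity may be zero or negative; division by
    \<open>C\<close> below requires a positive one.\<close>
  define C where "C = \<bar>C0\<bar> + 1"
  have C: "0 < C" and C0C: "C0 \<le> C" by (simp_all add: C_def)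
  have C1: "N u \<le> C * N' (T u)" if "u \<in> X" for u
    using C0[OF that] mult_right_mono[OF C0C N'0[OF that]] by linarith
  have V: "V \<in> X" and lin: "\<And>u v. u \<in> X \<Longrightarrow> v \<in> X \<Longrightarrow> D (u + v) = D u + D v"
    "\<And>u r. u \<in> X \<Longrightarrow> D (r *\<^sub>R u) = r * D u"
    using D unfolding frechet_on_def by blast+
  obtain E where E: "\<And>u. u \<in> X \<Longrightarrow> \<bar>D u\<bar> \<le> E * N u"
    using D unfolding frechet_on_def by blast
  have closed: "u + v \<in> X" "r *\<^sub>R u \<in> X" if "u \<in> X" "v \<in> X" for u v r
    using subspace_add[OF sub] subspace_scale[OF sub] that by blast+
  have bound: "\<bar>D' (T u)\<bar> \<le> (\<bar>E\<bar> * C) * N' (T u)" if u: "u \<in> X" for u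
  proof -
    have "\<bar>D u\<bar> \<le> \<bar>E\<bar> * N u"
      using E[OF u] mult_right_mono[OF abs_ge_self[of E] N[OF u]] by linarith
    also have "\<dots> \<le> \<bar>E\<bar> * (C * N' (T u))" by (rule mult_left_mono[OF C1[OF u]]) simp
    finally show ?thesis using D'[OF u] by (simp add: mult.assoc)
  qed
  have approx: "\<exists>\<delta>>0. \<forall>h\<in>X. N' (T h) < \<delta> \<longrightarrow>
      \<bar>F (T V + T h) - F (T V) - D' (T h)\<bar> \<le> \<epsilon> * N' (T h)" if \<epsilon>: "0 < \<epsilon>" for \<epsilon>
  proof -
    \<comment> \<open>Passing from \<open>N\<close> to \<open>N'\<close> costs a factor
      \<open>C\<close> in the error, paid for by \<open>\<epsilon> / C\<close>, and another in the
      radius, which becomes \<open>\<delta> / C\<close>.\<close>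
    obtain \<delta> where \<delta>: "0 < \<delta>"
      "\<And>h. h \<in> X \<Longrightarrow> N h < \<delta> \<Longrightarrow> \<bar>K (V + h) - K V - D h\<bar> \<le> (\<epsilon> / C) * N h"
      using frechet_on_approx[OF D divide_pos_pos[OF \<epsilon> C]] by blast
    have "\<bar>F (T V + T h) - F (T V) - D' (T h)\<bar> \<le> \<epsilon> * N' (T h)"
      if h: "h \<in> X" "N' (T h) < \<delta> / C" for h
    proof -
      have "C * N' (T h) < \<delta>" using h(2) C by (simp add: pos_less_divide_eq mult.commute)
      then have "N h < \<delta>" using C1[OF h(1)] by linarith
      then have "\<bar>K (V + h) - K V - D h\<bar> \<le> (\<epsilon> / C) * N h" by (rule \<delta>(2)[OF h(1)])
      also have "\<dots> \<le> (\<epsilon> / C) * (C * N' (T h))"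
        using \<epsilon> C by (intro mult_left_mono[OF C1[OF h(1)]]) simp
      also have "\<dots> = \<epsilon> * N' (T h)" using C by simp
      finally show ?thesis
        using F[OF V] F[OF closed(1)[OF V h(1)]] add[OF V h(1)] D'[OF h(1)] by simp
    qed
    then show ?thesis using \<delta>(1) C by (intro exI[of _ "\<delta> / C"]) simp
  qed
  show ?thesis
    unfolding frechet_on_def L[symmetric]
  proof (intro conjI ballI allI impI)
    show "T V \<in> T ` X" using V by blast
    show "D' (x + y) = D' x + D' y" if xy: "x \<in> T ` X" "y \<in> T ` X" for x y
    proof -
      obtain u v where uv: "u \<in> X" "v \<in> X" "x = T u" "y = T v" using xy by blast
      have "D' (T (u + v)) = D' (T u) + D' (T v)"
        by (simp add: D' closed uv lin)
      then show ?thesis by (simp add: uv add)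
    qed
    show "D' (r *\<^sub>R x) = r * D' x" if x: "x \<in> T ` X" for r x
    proof -
      obtain u where u: "u \<in> X" "x = T u" using x by blast
      have "D' (T (r *\<^sub>R u)) = r * D' (T u)"
        using closed(2)[OF u(1) u(1)] by (simp add: D' u lin)
      then show ?thesis by (simp add: u scale)
    qed
    show "\<exists>C. \<forall>x\<in>T ` X. \<bar>D' x\<bar> \<le> C * N' x" using bound by blast
    show "\<exists>\<delta>>0. \<forall>h\<in>T ` X. N' h < \<delta> \<longrightarrow> \<bar>F (T V + h) - F (T V) - D' h\<bar> \<le> \<epsilon> * N' h"
      if "0 < \<epsilon>" for \<epsilon>
      using approx[OF that] by (simp only: ball_simps)
  qed
qed


section \<open>The twisted functional derivatives\<close>

text \<open>The regularity classes \<open>X\<close>, \<open>L1\<close> and \<open>L2\<close> stay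
  abstract; the membership equivalences say that the two isomorphisms match them. Each derivative is
  asserted both as a property and as a value of \<open>THE\<close>, since the latter alone would not
  express existence.\<close>

theorem proposition6:
  fixes M :: "'a topology"
    and A :: "('a, 'n::{finite,linorder}) chart set"
    and g :: "('a, 'n) mfield"
    and X :: "('a, 'n) vfield set" and L1 L2 :: "('a, 'n) fform set"
    and N :: "('a, 'n) vfield \<Rightarrow> real" and N1 N2 :: "('a, 'n) fform \<Rightarrow> real"
    and K :: "('a, 'n) vfield \<Rightarrow> real" and K1 K2 :: "('a, 'n) fform \<Rightarrow> real"
    and V W :: "('a, 'n) vfield"
  assumes "riemannian_manifold M A g"
    and "X \<subseteq> vector_fields A" and "normed_subspace X N"
    and "L1 \<subseteq> straight_forms A 1" and "normed_subspace L1 N1"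
    and "L2 \<subseteq> twisted_forms A (CARD('n) - 1)" and "normed_subspace L2 N2"
    and "\<forall>U\<in>vector_fields A. flat g U \<in> L1 \<longleftrightarrow> U \<in> X"
    and "\<forall>U\<in>vector_fields A. interior_product U (volume_form g) \<in> L2 \<longleftrightarrow> U \<in> X"
    and "bicontinuous_on X N N1 (flat g)"
    and "bicontinuous_on X N N2 (\<lambda>U. interior_product U (volume_form g))"
    and "V \<in> X"
    and "has_variational_derivative M A g X N K V W"
    and "\<forall>U\<in>X. K1 (flat g U) = K U"
    and "\<forall>U\<in>X. K2 (interior_product U (volume_form g)) = K U"
  shows "has_twisted_derivative M A 1 L1 N1 L2 K1 (flat g V) (interior_product W (volume_form g)) \<and>
     twisted_derivative M A 1 L1 N1 L2 K1 (flat g V) = interior_product W (volume_form g) \<and>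
     has_twisted_derivative_tw M A (CARD('n) - 1) L2 N2 L1 K2
           (interior_product V (volume_form g)) (flat g W) \<and>
     twisted_derivative_tw M A (CARD('n) - 1) L2 N2 L1 K2
           (interior_product V (volume_form g)) = flat g W"
proof -
  let ?i = "\<lambda>U. interior_product U (volume_form g)"
  have M: "smooth_manifold M A" and g: "riemannian_metric A g"
    using assms(1) unfolding riemannian_manifold_def by blast+
  have sub: "subspace X" using assms(3) unfolding normed_subspace_def by blast
  obtain D where W: "W \<in> X" and D: "frechet_on X N K V D"
    and conv: "\<And>U. U \<in> X \<Longrightarrow> twisted_integrable M A (scale_form (metric_dot g W U) (volume_form g))"
    and D_eq: "\<And>U. U \<in> X \<Longrightarrow> D U = twisted_integral M A (scale_form (metric_dot g W U) (volume_form g))"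
    using assms(13) unfolding has_variational_derivative_def by blast
  have card: "CARD('n) - (CARD('n) - 1) = 1"
    using zero_less_card_finite[where 'a='n] by linarith
  \<comment> \<open>A form in \<open>L1\<close> comes from some smooth vector field by
    \<open>flat_surj\<close>; the membership equivalence then places that field in
    \<open>X\<close>.\<close>
  have flat_img: "flat g ` X = L1"
  proof
    show "flat g ` X \<subseteq> L1" using assms(2,8) by blast
    show "L1 \<subseteq> flat g ` X"
    proof
      fix \<eta> assume \<eta>: "\<eta> \<in> L1"
      then obtain U where "U \<in> vector_fields A" "flat g U = \<eta>"
        using flat_surj[OF M g] assms(4) by blast
      then show "\<eta> \<in> flat g ` X" using assms(8) \<eta> by blast
    qed
  qed
  have i_img: "?i ` X = L2"
  proof
    show "?i ` X \<subseteq> L2" using assms(2,9) by blast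
    show "L2 \<subseteq> ?i ` X"
    proof
      fix \<zeta> assume \<zeta>: "\<zeta> \<in> L2"
      then obtain U where "U \<in> vector_fields A" "?i U = \<zeta>"
        using interior_product_volume_form_surj[OF M g] assms(6) by blast
      then show "\<zeta> \<in> ?i ` X" using assms(9) \<zeta> by blast
    qed
  qed
  have eqI: "Z = W" if Z: "Z \<in> X"
    and Zi: "\<And>U. U \<in> X \<Longrightarrow> twisted_integrable M A (scale_form (metric_dot g Z U) (volume_form g))"
    and eq: "\<And>U. U \<in> X \<Longrightarrow> twisted_integral M A (scale_form (metric_dot g Z U) (volume_form g)) = D U" for Z
  proof -
    have Y: "Z - W \<in> X" by (rule subspace_diff[OF sub Z W])
    then show ?thesis
      using assms(2) Zi conv eq D_eq by (intro vector_field_eqI[OF M g]) auto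
  qed
  \<comment> \<open>Pairing \<open>flat g W\<close> with \<open>?i U\<close> yields g(U, W), while
    the variational derivative is stated with g(W, U).\<close>
  have swap: "metric_dot g U W = metric_dot g W U" for U W
    by (intro ext metric_dot_commute[OF g])

  \<comment> \<open>Any functional on forms that pulls back to \<open>D\<close> will do, so the
    pairing itself can be inserted without inverting \<open>flat\<close>.\<close>
  have fr1: "frechet_on L1 N1 K1 (flat g V) D1" if "\<And>U. U \<in> X \<Longrightarrow> D1 (flat g U) = D U" for D1
    using assms(14) that
    by (intro frechet_on_transport[OF assms(3,5) flat_img flat_add flat_scaleR assms(10) _ _ D]) auto
  have fr2: "frechet_on L2 N2 K2 (?i V) D2" if "\<And>U. U \<in> X \<Longrightarrow> D2 (?i U) = D U" for D2
    using assms(15) that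
    by (intro frechet_on_transport[OF assms(3,7) i_img interior_product_volume_form_add
          interior_product_volume_form_scaleR assms(11) _ _ D]) auto

  let ?D1 = "\<lambda>\<eta>. poincare_pairing M A 1 \<eta> (?i W)"
  let ?D2 = "\<lambda>\<eta>. poincare_pairing M A 1 (flat g W) \<eta>"
  have fr1': "frechet_on L1 N1 K1 (flat g V) ?D1"
    by (rule fr1) (simp only: pairing_flat_interior_product D_eq)
  have fr2': "frechet_on L2 N2 K2 (?i V) ?D2"
    by (rule fr2) (simp only: pairing_flat_interior_product D_eq swap[of _ W])

  have d1: "has_twisted_derivative M A 1 L1 N1 L2 K1 (flat g V) (?i W)"
    unfolding has_twisted_derivative_def
  proof (intro conjI exI[of _ ?D1] ballI)
    show "?i W \<in> L2" using i_img W by blast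
    show "pairing_converges M A 1 \<eta> (?i W)" if "\<eta> \<in> L1" for \<eta>
      using that conv unfolding flat_img[symmetric] by (auto simp only: pairing_flat_interior_product)
  qed (use assms(4,6) fr1' in simp_all)
  have d2: "has_twisted_derivative_tw M A (CARD('n) - 1) L2 N2 L1 K2 (?i V) (flat g W)"
    unfolding has_twisted_derivative_tw_def card
  proof (intro conjI exI[of _ ?D2] ballI)
    show "flat g W \<in> L1" using flat_img W by blast
    show "pairing_converges M A 1 (flat g W) \<eta>" if "\<eta> \<in> L2" for \<eta>
      using that conv unfolding i_img[symmetric]
      by (auto simp only: pairing_flat_interior_product swap[of _ W])
  qed (use assms(4,6) fr2' in simp_all)

  \<comment> \<open>A competing form comes with its own derivative functional;
    \<open>frechet_on_unique\<close> identifies it with \<open>?D1\<close>, and surjectivity onto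
    \<open>L2\<close> turns the form into a vector field to which \<open>eqI\<close>
    applies.\<close>
  have u1: "\<zeta> = ?i W" if \<zeta>: "has_twisted_derivative M A 1 L1 N1 L2 K1 (flat g V) \<zeta>" for \<zeta>
  proof -
    obtain D1 where D1: "frechet_on L1 N1 K1 (flat g V) D1" and "\<zeta> \<in> L2"
      and D1_eq: "\<And>\<eta>. \<eta> \<in> L1 \<Longrightarrow> pairing_converges M A 1 \<eta> \<zeta> \<and> D1 \<eta> = poincare_pairing M A 1 \<eta> \<zeta>"
      using \<zeta> unfolding has_twisted_derivative_def by blast
    then obtain Z where Z: "Z \<in> X" "\<zeta> = ?i Z" using i_img by blast
    have "Z = W"
    proof (rule eqI[OF Z(1)])
      fix U assume U: "U \<in> X"
      then have fU: "flat g U \<in> L1" using flat_img by blast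
      show "twisted_integrable M A (scale_form (metric_dot g Z U) (volume_form g))"
        using D1_eq[OF fU] unfolding Z(2) pairing_flat_interior_product by blast
      show "twisted_integral M A (scale_form (metric_dot g Z U) (volume_form g)) = D U"
        using D1_eq[OF fU] frechet_on_unique[OF assms(5) D1 fr1' fU] D_eq[OF U]
        unfolding Z(2) pairing_flat_interior_product by simp
    qed
    then show ?thesis using Z(2) by simp
  qed
  have u2: "\<zeta> = flat g W"
    if \<zeta>: "has_twisted_derivative_tw M A (CARD('n) - 1) L2 N2 L1 K2 (?i V) \<zeta>" for \<zeta>
  proof -
    obtain D2 where D2: "frechet_on L2 N2 K2 (?i V) D2" and "\<zeta> \<in> L1"
      and D2_eq: "\<And>\<eta>. \<eta> \<in> L2 \<Longrightarrow> pairing_converges M A 1 \<zeta> \<eta> \<and> D2 \<eta> = poincare_pairing M A 1 \<zeta> \<eta>"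
      using \<zeta> unfolding has_twisted_derivative_tw_def card by blast
    then obtain Z where Z: "Z \<in> X" "\<zeta> = flat g Z" using flat_img by blast
    have "Z = W"
    proof (rule eqI[OF Z(1)])
      fix U assume U: "U \<in> X"
      then have iU: "?i U \<in> L2" using i_img by blast
      show "twisted_integrable M A (scale_form (metric_dot g Z U) (volume_form g))"
        using D2_eq[OF iU] unfolding Z(2) pairing_flat_interior_product swap[of U Z] by blast
      show "twisted_integral M A (scale_form (metric_dot g Z U) (volume_form g)) = D U"
        using D2_eq[OF iU] frechet_on_unique[OF assms(7) D2 fr2' iU] D_eq[OF U]
        unfolding Z(2) pairing_flat_interior_product swap[of U Z] swap[of U W] by simp
    qed
    then show ?thesis using Z(2) by simp
  qed

  show ?thesis
    unfolding twisted_derivative_def twisted_derivative_tw_def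
    by (intro conjI d1 d2 the_equality u1 u2)
qed

end
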